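(* Let $k$ and $n$ be positive integers such that $8\leqslant 2k\leqslant n<(k+1)^3$, and let $a_0,a_1,\ldots,a_k$ be non-zero integers each of which has all of its prime factors $\leqslant k$. Define $$c_j=(-1)^{k-j}\binom{n}{j}\binom{n-j-1}{k-j}\quad (0\leqslant j\leqslant k),\qquad F_{n,k}(x)=\sum_{j=0}^{k}a_jc_jx^j.$$ Then $F_{n,k}(x)$ is irreducible over $\mathbb{Q}$, except possibly when $(n,k)\in\{(8,4),(10,5),(12,6),(16,8)\}$.
   Context: The $c_j$ are the coefficients of $P_{n,k}(x-1)=\sum_{j=0}^k c_jx^j$, where $P_{n,k}(x)=\sum_{j=0}^k\binom{n}{j}x^j$. Equivalently, $c_j=\frac{(-1)^{k-j}\,n(n-1)\cdots(n-k)}{j!\,(k-j)!\,(n-j)}$. *)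

theory Defs
  imports "HOL-Computational_Algebra.Computational_Algebra"
begin

text \<open>The subtraction on naturals in \<open>n - j - 1\<close> is only meaningful for \<open>j < n\<close>; it is used for
  \<open>j \<le> k\<close> with \<open>2 * k \<le> n\<close> and \<open>k > 0\<close>, where it does not truncate.\<close>

definition c_coeff :: "nat \<Rightarrow> nat \<Rightarrow> nat \<Rightarrow> int" where
  "c_coeff n k j = (-1) ^ (k - j) * int (n choose j) * int ((n - j - 1) choose (k - j))"

text \<open>The coefficients are integers; the polynomial is taken over the rationals because
  irreducibility over the field of rationals is the property of interest.\<close>

definition F_poly :: "nat \<Rightarrow> nat \<Rightarrow> (nat \<Rightarrow> int) \<Rightarrow> rat poly" where
  "F_poly n k a = (\<Sum>j\<le>k. monom (of_int (a j * c_coeff n k j)) j)"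

end

(*
  A factor of degree r of F, 1 <= r <= k/2, is constrained by every prime p > k dividing some n - l
  with 0 <= l <= k: then p divides no other n - i, so all coefficients of F have the same p-adic
  valuation e, except the l-th one, which is a unit, and e <= 2 since n < (k+1)^3. The Newton polygon
  has the edges from 0 to l and from l to k, and r is a sum of pieces of them between lattice points:
  for e = 1 this forces l = r or l = k - r, for e = 2 it forces l in {r, k-r, 2r, k-2r} or r = k/2
  with l even.
  Hence about half of n, n-1, ..., n-k, or nearly all, are k-smooth. Erdos' argument (discard for each prime p <= k
  a term with maximal p-adic valuation; the product of the others divides k!) refutes this unless
  k is small or n < 4k. When n < 4k, three primes in [3n/4, n] suffice for moderate n, and for large k
  the binomial coefficient n over k is too big for the product of its prime power divisors, as in
  Erdos' proof of Bertrand's postulate. What remains is a finite list of pairs (n, k).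
*)
theory Submission
  imports Defs "HOL-Analysis.Harmonic_Numbers"
begin

section \<open>Newton polygons of integer polynomials\<close>

text \<open>Only primes above k are informative: the a_j may contain arbitrary powers of smaller
  primes, which also enter through j! (k-j)! in the closed form of c_j. The hypothesis n < (k+1)^3
  gives p^3 > n for such primes, and this is where e <= 2 comes from. The degree r = k/2 is the
  worst case. If p^2 divides n - l with l even, both edges may break at their midpoints, so even l
  yield no constraint. Only about k/2 odd positions remain, and in the resulting inequality the
  leading logarithmic terms cancel; this is why the finite checks for r = k/2 go up to k = 30, and
  to n near 6900 at k = 18. The four exceptional pairs are exactly those for which some degree
  survives every constraint from primes above k: r = 1 for (8,4), with 7 at l = 1 and 5 at l = 3; r
  = 2 for (10,5), with 7 at l = 3; r = 1 for (12,6), with 11 at l = 1 and 7 at l = 5; r = 3 for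
  (16,8), with 13 at l = 3 and 11 at l = 5.\<close>

text \<open>A line of slope -b/a in the plane of the points (j, valuation of the j-th coefficient)
  is a level set of this functional; multiplying by a keeps it integral. The multiplicity of a zero
  coefficient is the default 0, so every use is guarded by
  \<open>coeff g j \<noteq> 0\<close>.\<close>

definition newton_weight :: "int \<Rightarrow> int \<Rightarrow> int \<Rightarrow> int poly \<Rightarrow> nat \<Rightarrow> int" where
  "newton_weight p a b g j = a * int (multiplicity p (coeff g j)) + b * int j"

text \<open>Lexicographic minimum of the weight and \<open>s * j\<close>: \<open>s = 1\<close> selects the left and \<open>s = -1\<close> the
  right end of the edge of the Newton polygon with slope \<open>- b / a\<close>.\<close>

definition newton_vertex ::
    "int \<Rightarrow> int \<Rightarrow> int \<Rightarrow> int \<Rightarrow> int poly \<Rightarrow> int \<Rightarrow> nat \<Rightarrow> bool" where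
  "newton_vertex p a b s g m i \<longleftrightarrow> coeff g i \<noteq> 0 \<and> newton_weight p a b g i = m \<and>
     (\<forall>j. coeff g j \<noteq> 0 \<longrightarrow>
        newton_weight p a b g j > m \<or> newton_weight p a b g j = m \<and> s * int j \<ge> s * int i)"

lemma newton_vertex_exists:
  assumes "g \<noteq> 0"
  shows "\<exists>m i. newton_vertex p a b s g m i"
proof -
  define S where "S = {j. coeff g j \<noteq> 0}"
  have fin: "finite S"
    by (rule finite_subset[of _ "{..degree g}"]) (auto simp: S_def intro: le_degree)
  have ne: "S \<noteq> {}"
    using assms by (auto simp: S_def poly_eq_iff)
  define m where "m = Min (newton_weight p a b g ` S)"
  define T where "T = {j \<in> S. newton_weight p a b g j = m}"
  have "m \<in> newton_weight p a b g ` S"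
    unfolding m_def using fin ne by (intro Min_in) auto
  then have T: "finite T" "T \<noteq> {}" using fin by (auto simp: T_def)
  define t where "t = Min ((\<lambda>j. s * int j) ` T)"
  have "t \<in> (\<lambda>j. s * int j) ` T"
    unfolding t_def using T by (intro Min_in) auto
  then obtain i where i: "i \<in> T" "t = s * int i" by auto
  have "newton_vertex p a b s g m i"
    unfolding newton_vertex_def
  proof (intro conjI allI impI)
    show "coeff g i \<noteq> 0" "newton_weight p a b g i = m" using i by (auto simp: T_def S_def)
    fix j assume "coeff g j \<noteq> 0"
    then have j: "j \<in> S" by (simp add: S_def)
    then have "m \<le> newton_weight p a b g j" unfolding m_def using fin by auto
    moreover have "s * int i \<le> s * int j" if "newton_weight p a b g j = m"
    proof -
      have "j \<in> T" using that j by (simp add: T_def)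
      then have "t \<le> s * int j" unfolding t_def using T by (intro Min_le) auto
      then show ?thesis using i by simp
    qed
    ultimately show "newton_weight p a b g j > m \<or>
        newton_weight p a b g j = m \<and> s * int j \<ge> s * int i" by fastforce
  qed
  then show ?thesis by blast
qed

lemma newton_vertex_unique:
  assumes "newton_vertex p a b s g m i" "newton_vertex p a b s g m' i'" "s = 1 \<or> s = -1"
  shows "m = m'" "i = i'"
proof -
  have 1: "coeff g i \<noteq> 0" "coeff g i' \<noteq> 0" "newton_weight p a b g i = m"
      "newton_weight p a b g i' = m'"
    using assms by (auto simp: newton_vertex_def)
  have 2: "m' > m \<or> m' = m \<and> s * int i' \<ge> s * int i"
    using assms(1) 1 unfolding newton_vertex_def by auto
  have 3: "m > m' \<or> m = m' \<and> s * int i \<ge> s * int i'"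
    using assms(2) 1 unfolding newton_vertex_def by auto
  show "m = m'" using 2 3 by auto
  show "i = i'" using 2 3 assms(3) by auto
qed

text \<open>Both values are the minimal weight over all nonzero coefficients; \<open>s\<close> only
  chooses among the indices that attain it. This puts the two ends of an edge on one line.\<close>

lemma newton_vertex_tie_independent:
  assumes "newton_vertex p a b s g m i" "newton_vertex p a b s' g m' i'"
  shows "m = m'"
proof -
  have 1: "coeff g i \<noteq> 0" "coeff g i' \<noteq> 0" "newton_weight p a b g i = m"
      "newton_weight p a b g i' = m'"
    using assms by (auto simp: newton_vertex_def)
  have "m \<le> m'" using assms(1) 1 unfolding newton_vertex_def by fastforce
  moreover have "m' \<le> m" using assms(2) 1 unfolding newton_vertex_def by fastforce
  ultimately show ?thesis by simp
qed

text \<open>Dumas' theorem, seen as multiplicativity of leading terms: weight followed by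
  \<open>s * j\<close> is a lexicographic order compatible with addition, so a single product of
  coefficients is minimal at index \<open>i0 + j0\<close>, and there the ultrametric inequality is
  an equality.\<close>

lemma newton_vertex_mult:
  assumes p: "prime p" and a: "a > 0" and s: "s = 1 \<or> s = -1"
    and G: "newton_vertex p a b s G m i0" and H: "newton_vertex p a b s H m' j0"
  shows "newton_vertex p a b s (G * H) (m + m') (i0 + j0)"
proof -
  let ?v = "multiplicity p"
  define t where "t = (\<lambda>j i. coeff G i * coeff H (j - i))"
  have cm: "coeff (G * H) j = (\<Sum>i\<le>j. t j i)" for j
    by (simp add: coeff_mult t_def)
  have pe: "prime_elem p" using p by (rule prime_imp_prime_elem)
  have npu: "\<not> is_unit p" using pe by (rule prime_elem_not_unit)
  have W: "newton_weight p a b G i + newton_weight p a b H (j - i)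
      = a * int (?v (t j i)) + b * int j"
    if ij: "i \<le> j" "t j i \<noteq> 0" for i j
  proof -
    have "?v (t j i) = ?v (coeff G i) + ?v (coeff H (j - i))"
      unfolding t_def using that pe by (intro prime_elem_multiplicity_mult_distrib) (auto simp: t_def)
    moreover obtain d where "j = i + d" using ij(1) le_Suc_ex by blast
    ultimately show ?thesis by (simp add: newton_weight_def algebra_simps)
  qed
  have lex: "newton_weight p a b G i + newton_weight p a b H (j - i) > m + m' \<or>
     newton_weight p a b G i + newton_weight p a b H (j - i) = m + m' \<and>
     newton_weight p a b G i = m \<and>
     s * int i \<ge> s * int i0 \<and> s * int (j - i) \<ge> s * int j0"
    if "t j i \<noteq> 0" for i j
  proof -
    have "coeff G i \<noteq> 0" "coeff H (j - i) \<noteq> 0" using that by (auto simp: t_def)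
    then have "newton_weight p a b G i > m \<or> newton_weight p a b G i = m \<and> s * int i \<ge> s * int i0"
      "newton_weight p a b H (j - i) > m' \<or>
       newton_weight p a b H (j - i) = m' \<and> s * int (j - i) \<ge> s * int j0"
      using G H unfolding newton_vertex_def by auto
    then show ?thesis by linarith
  qed
  define k where "k = i0 + j0"
  define v0 where "v0 = ?v (t k i0)"
  have t0: "t k i0 \<noteq> 0" using G H by (simp add: t_def k_def newton_vertex_def)
  have w0: "m + m' = a * int v0 + b * int k"
    using W[of i0 k] t0 G H by (simp add: v0_def k_def newton_vertex_def)
  \<comment> \<open>Equal weight would place \<open>i\<close> and \<open>k - i\<close> weakly beyond
    \<open>i0\<close> and \<open>j0\<close> in the direction of \<open>s\<close>; as their sum is
    \<open>i0 + j0\<close>, this forces \<open>i = i0\<close>.\<close>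
  have big: "p ^ Suc v0 dvd t k i" if i: "i \<le> k" "i \<noteq> i0" for i
  proof (cases "t k i = 0")
    case False
    have "newton_weight p a b G i + newton_weight p a b H (k - i) > m + m'"
    proof (rule ccontr)
      assume "\<not> ?thesis"
      then have "s * int i \<ge> s * int i0 \<and> s * int (k - i) \<ge> s * int j0"
        using lex[OF False] by blast
      then have "i = i0" using s i by (auto simp: k_def)
      then show False using i by simp
    qed
    then have "a * int (?v (t k i)) > a * int v0" using W[OF i(1) False] w0 by simp
    then have "Suc v0 \<le> ?v (t k i)" using a by simp
    then show ?thesis by (rule multiplicity_dvd')
  qed simp
  have sum0: "coeff (G * H) k = t k i0 + (\<Sum>i\<in>{..k} - {i0}. t k i)"
    unfolding cm by (rule sum.remove) (auto simp: k_def)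
  have rest: "p ^ Suc v0 dvd (\<Sum>i\<in>{..k} - {i0}. t k i)"
    by (rule dvd_sum) (use big in auto)
  have ndvd: "\<not> p ^ Suc v0 dvd t k i0"
    using t0 npu by (subst power_dvd_iff_le_multiplicity) (auto simp: v0_def)
  have nd: "\<not> p ^ Suc v0 dvd coeff (G * H) k"
    using ndvd rest sum0 by (simp add: dvd_add_left_iff)
  have "p ^ v0 dvd t k i0" unfolding v0_def by (rule multiplicity_dvd)
  moreover have "p ^ v0 dvd (\<Sum>i\<in>{..k} - {i0}. t k i)"
    using rest by (meson dvd_trans le_imp_power_dvd lessI less_imp_le)
  ultimately have yd: "p ^ v0 dvd coeff (G * H) k" unfolding sum0 by (rule dvd_add)
  have vk: "?v (coeff (G * H) k) = v0" using yd nd by (intro multiplicity_eqI)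
  show ?thesis
    unfolding newton_vertex_def k_def[symmetric]
  proof (intro conjI allI impI)
    show "coeff (G * H) k \<noteq> 0" using nd by auto
    show "newton_weight p a b (G * H) k = m + m'" using vk w0 by (simp add: newton_weight_def)
    fix j assume cj: "coeff (G * H) j \<noteq> 0"
    define v where "v = ?v (coeff (G * H) j)"
    \<comment> \<open>If all summands had a larger valuation, so would the sum. The term found here
      carries the lower bound for the weight at \<open>j\<close>.\<close>
    have "\<exists>i\<le>j. t j i \<noteq> 0 \<and> ?v (t j i) \<le> v"
    proof (rule ccontr)
      assume *: "\<not> ?thesis"
      have "p ^ Suc v dvd t j i" if "i \<le> j" for i
      proof (cases "t j i = 0")
        case False
        then have "Suc v \<le> ?v (t j i)" using * that by fastforce
        then show ?thesis by (rule multiplicity_dvd')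
      qed simp
      then have "p ^ Suc v dvd coeff (G * H) j" unfolding cm by (intro dvd_sum) auto
      then show False
        using cj npu by (subst (asm) power_dvd_iff_le_multiplicity) (auto simp: v_def)
    qed
    then obtain i where i: "i \<le> j" "t j i \<noteq> 0" "?v (t j i) \<le> v" by blast
    have "a * int (?v (t j i)) \<le> a * int v" using i a by simp
    then have ge: "newton_weight p a b (G * H) j \<ge>
        newton_weight p a b G i + newton_weight p a b H (j - i)"
      unfolding W[OF i(1,2)] by (simp add: newton_weight_def v_def)
    obtain d where "j = i + d" using i(1) le_Suc_ex by blast
    then have "s * int j = s * int i + s * int (j - i)" "s * int k = s * int i0 + s * int j0"
      by (simp_all add: k_def distrib_left)
    then show "newton_weight p a b (G * H) j > m + m' \<or>
        newton_weight p a b (G * H) j = m + m' \<and> s * int j \<ge> s * int k"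
      using lex[OF i(2)] ge by linarith
  qed
qed

text \<open>The factors have vertices, these add up to a vertex of the product, and the product has
  only one for a given slope and side.\<close>

lemma newton_vertex_factors:
  assumes p: "prime p" and a: "a > 0" and s: "s = 1 \<or> s = -1"
    and F: "newton_vertex p a b s (G * H) m k" and nz: "G \<noteq> 0" "H \<noteq> 0"
  shows "\<exists>m1 m2 i j. newton_vertex p a b s G m1 i \<and> newton_vertex p a b s H m2 j \<and> k = i + j"
proof -
  obtain m1 i where 1: "newton_vertex p a b s G m1 i" using newton_vertex_exists nz by blast
  obtain m2 j where 2: "newton_vertex p a b s H m2 j" using newton_vertex_exists nz by blast
  have "newton_vertex p a b s (G * H) (m1 + m2) (i + j)"
    using p a s 1 2 by (rule newton_vertex_mult)
  then have "k = i + j" using F s newton_vertex_unique by blast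
  then show ?thesis using 1 2 by blast
qed

lemma newton_vertex_le_degree: "newton_vertex p a b s g m i \<Longrightarrow> i \<le> degree g"
  by (simp add: newton_vertex_def le_degree)

text \<open>By convexity an edge of negative slope lies to the left of one of positive slope.\<close>

lemma newton_vertex_slopes_le:
  assumes "newton_vertex p a e (-1) g m i" "newton_vertex p a' (- e) 1 g m' j"
    and "a > 0" "a' > 0" "e > 0"
  shows "i \<le> j"
proof (rule ccontr)
  assume "\<not> i \<le> j"
  then have d: "e * int j < e * int i" using assms by simp
  define v where "v = (\<lambda>i. int (multiplicity p (coeff g i)))"
  have nz: "coeff g i \<noteq> 0" "coeff g j \<noteq> 0" using assms by (auto simp: newton_vertex_def)
  have "newton_weight p a e g j \<ge> newton_weight p a e g i"
    using assms(1) nz by (auto simp: newton_vertex_def)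
  then have "a * v i < a * v j" using d by (simp add: newton_weight_def v_def)
  then have "v i < v j" using assms by simp
  have "newton_weight p a' (-e) g i \<ge> newton_weight p a' (-e) g j"
    using assms(2) nz by (auto simp: newton_vertex_def)
  then have "a' * v j < a' * v i" using d by (simp add: newton_weight_def v_def)
  then have "v j < v i" using assms by simp
  then show False using \<open>v i < v j\<close> by simp
qed

lemma newton_vertexI:
  assumes "coeff g i \<noteq> 0" "newton_weight p a b g i = m"
    and "\<And>j. coeff g j \<noteq> 0 \<Longrightarrow>
      newton_weight p a b g j > m \<or> newton_weight p a b g j = m \<and> s * int j \<ge> s * int i"
  shows "newton_vertex p a b s g m i"
  using assms by (simp add: newton_vertex_def)

text \<open>\<open>i\<close> and \<open>i'\<close> are the horizontal lengths of the shares of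
  \<open>G\<close> in the left and the right edge. Along its share of the left edge \<open>G\<close>
  drops by e * i / l, a difference of valuations and hence an integer; likewise on the right. The
  offset \<open>c\<close> leaves room for a constant factor of \<open>F\<close>. For
  \<open>l = 0\<close> or \<open>l = k\<close> one edge is missing and its share has length
  0.\<close>

lemma newton_polygon_degree:
  fixes F G H :: "int poly" and p :: int and c e l k :: nat
  assumes F: "F = G * H" and p: "prime p" and e: "e > 0" and l: "l \<le> k"
    and deg: "degree F = k"
    and nz: "\<And>j. j \<le> k \<Longrightarrow> coeff F j \<noteq> 0"
    and val: "\<And>j. j \<le> k \<Longrightarrow> multiplicity p (coeff F j) = (if j = l then c else c + e)"
  shows "\<exists>i i'. degree G = i + i' \<and> i \<le> l \<and> i' \<le> k - l \<and> l dvd e * i \<and> (k - l) dvd e * i'"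
proof -
  have "F \<noteq> 0" using nz[of 0] by auto
  then have GH: "G \<noteq> 0" "H \<noteq> 0" using F by auto
  then have dk: "degree G + degree H = k" using deg F by (simp add: degree_mult_eq)
  have jk: "j \<le> k" if "coeff F j \<noteq> 0" for j using that deg le_degree by blast
  \<comment> \<open>\<open>\<beta>\<close> and \<open>\<beta>'\<close> are the right ends of the
    shares of \<open>G\<close> and \<open>H\<close> in the left edge. The vertex facts are kept to
    glue these shares to those of the right edge; the slope -e/l makes sense only for
    \<open>l > 0\<close>.\<close>
  have left: "\<exists>\<beta> \<beta>'. \<beta> + \<beta>' = l \<and> l dvd e * \<beta> \<and> \<beta> \<le> degree G \<and> \<beta>' \<le> degree H \<and> (l > 0 \<longrightarrow>
      (\<exists>m. newton_vertex p l e (-1) G m \<beta>) \<and> (\<exists>m. newton_vertex p l e (-1) H m \<beta>'))"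
  proof (cases "l = 0")
    case False
    let ?m = "int l * (c + e)"
    have w: "newton_weight p l e F j = (if j = l then ?m else ?m + e * j)" if "j \<le> k" for j
      using that by (simp add: newton_weight_def val algebra_simps)
    have v1: "newton_vertex p l e 1 F ?m 0"
    proof (rule newton_vertexI)
      fix j assume "coeff F j \<noteq> 0"
      then have "j \<le> k" by (rule jk)
      then show "newton_weight p l e F j > ?m \<or> newton_weight p l e F j = ?m \<and> 1 * int j \<ge> 1 * int 0"
        using False by (auto simp: w zero_less_mult_iff)
    qed (use nz False in \<open>simp_all add: w\<close>)
    have v2: "newton_vertex p l e (-1) F ?m l"
    proof (rule newton_vertexI)
      fix j assume "coeff F j \<noteq> 0"
      then have "j \<le> k" by (rule jk)
      then show "newton_weight p l e F j > ?m \<or> newton_weight p l e F j = ?m \<and> (-1) * int j \<ge> (-1) * int l"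
        using l e by (auto simp: w zero_less_mult_iff)
    qed (use nz l e in \<open>simp_all add: w\<close>)
    have l0: "int l > 0" using False by simp
    obtain m1 m2 i j where 1: "newton_vertex p l e 1 G m1 i" "newton_vertex p l e 1 H m2 j"
        "0 = i + j"
      using newton_vertex_factors[OF p l0 disjI1[OF refl] v1[unfolded F] GH] by blast
    obtain m3 m4 \<beta> \<beta>' where 2: "newton_vertex p l e (-1) G m3 \<beta>"
        "newton_vertex p l e (-1) H m4 \<beta>'" "l = \<beta> + \<beta>'"
      using newton_vertex_factors[OF p l0 disjI2[OF refl] v2[unfolded F] GH] by blast
    \<comment> \<open>The share of \<open>G\<close> starts at \<open>i = 0\<close> because
      \<open>0 = i + j\<close>. Equal weights at its two ends turn into the divisibility by
      \<open>l\<close>.\<close>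
    have "m1 = m3" using newton_vertex_tie_independent 1(1) 2(1) by blast
    then have "newton_weight p l e G i = newton_weight p l e G \<beta>"
      using 1(1) 2(1) by (simp add: newton_vertex_def)
    then have "int (e * \<beta>) = int l * (int (multiplicity p (coeff G i)) -
        int (multiplicity p (coeff G \<beta>)))"
      using 1(3) by (simp add: newton_weight_def algebra_simps)
    then have "int l dvd int (e * \<beta>)" by (metis dvd_triv_left)
    then have "l dvd e * \<beta>" by (simp only: int_dvd_int_iff)
    then show ?thesis using 2 newton_vertex_le_degree by metis
  qed auto
  then obtain \<beta> \<beta>' where L: "\<beta> + \<beta>' = l" "l dvd e * \<beta>" "\<beta> \<le> degree G" "\<beta>' \<le> degree H"
      "l > 0 \<Longrightarrow> \<exists>m. newton_vertex p l e (-1) G m \<beta>"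
      "l > 0 \<Longrightarrow> \<exists>m. newton_vertex p l e (-1) H m \<beta>'" by blast
  show ?thesis
  proof (cases "l = k")
    case True
    then have "degree G = \<beta>" using L dk by simp
    then show ?thesis using L True by (intro exI[of _ \<beta>] exI[of _ 0]) simp
  next
    case False
    define A where "A = int (k - l)"
    have a: "A > 0" using l False by (simp add: A_def)
    let ?m = "A * c - int e * l"
    have w: "newton_weight p A (- int e) F j = (if j = l then ?m else ?m + int e * (int k - int j))"
      if "j \<le> k" for j
      using that l by (simp add: newton_weight_def val A_def algebra_simps of_nat_diff)
    have v1: "newton_vertex p A (- int e) 1 F ?m l"
    proof (rule newton_vertexI)
      fix j assume "coeff F j \<noteq> 0"
      then have "j \<le> k" by (rule jk)
      then show "newton_weight p A (- int e) F j > ?m \<or> newton_weight p A (- int e) F j = ?m \<and> 1 * int j \<ge> 1 * int l"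
        using l e by (auto simp: w zero_less_mult_iff)
    qed (use nz l e in \<open>simp_all add: w\<close>)
    have v2: "newton_vertex p A (- int e) (-1) F ?m k"
    proof (rule newton_vertexI)
      fix j assume "coeff F j \<noteq> 0"
      then have "j \<le> k" by (rule jk)
      then show "newton_weight p A (- int e) F j > ?m \<or> newton_weight p A (- int e) F j = ?m \<and> (-1) * int j \<ge> (-1) * int k"
        using l e False by (auto simp: w zero_less_mult_iff)
    qed (use nz l e False in \<open>simp_all add: w\<close>)
    obtain m1 m2 i j where 1: "newton_vertex p A (- int e) 1 G m1 i"
        "newton_vertex p A (- int e) 1 H m2 j" "l = i + j"
      using newton_vertex_factors[OF p a disjI1[OF refl] v1[unfolded F] GH] by blast
    obtain m3 m4 d d' where 2: "newton_vertex p A (- int e) (-1) G m3 d"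
        "newton_vertex p A (- int e) (-1) H m4 d'" "k = d + d'"
      using newton_vertex_factors[OF p a disjI2[OF refl] v2[unfolded F] GH] by blast
    have d: "d = degree G" using 2 dk newton_vertex_le_degree[OF 2(1)] newton_vertex_le_degree[OF 2(2)]
      by simp
    have "m1 = m3" using newton_vertex_tie_independent 1(1) 2(1) by blast
    then have "newton_weight p A (- int e) G i = newton_weight p A (- int e) G d"
      using 1(1) 2(1) by (simp add: newton_vertex_def)
    then have eq: "int e * (int d - int i) = A * (int (multiplicity p (coeff G d)) -
        int (multiplicity p (coeff G i)))"
      by (simp add: newton_weight_def algebra_simps)
    \<comment> \<open>The edges of each factor meet: convexity gives \<open>\<beta> \<le> i\<close>
      and \<open>\<beta>' \<le> j\<close>, while both pairs have sum \<open>l\<close>.\<close>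
    have "i = \<beta>"
    proof (cases "l = 0")
      case False
      then have "int l > 0" "int e > 0" using e by auto
      then have "\<beta> \<le> i" "\<beta>' \<le> j"
        using newton_vertex_slopes_le[OF _ 1(1) _ a] newton_vertex_slopes_le[OF _ 1(2) _ a]
          L(5,6) False by blast+
      then show ?thesis using 1(3) L(1) by simp
    qed (use 1 L in auto)
    have "int (e * (degree G - \<beta>)) = int e * (int d - int i)"
      using L(3) d \<open>i = \<beta>\<close> by (simp add: of_nat_diff)
    then have "A dvd int (e * (degree G - \<beta>))" using eq by (metis dvd_triv_left)
    then have "(k - l) dvd e * (degree G - \<beta>)" by (simp only: A_def int_dvd_int_iff)
    moreover have "degree G - \<beta> \<le> k - l" using L dk by linarith
    ultimately show ?thesis
      using L by (intro exI[of _ \<beta>] exI[of _ "degree G - \<beta>"]) simp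
  qed
qed

section \<open>Valuations of the coefficients\<close>

lemma multiplicity_int_int: "multiplicity (int p) (int x) = multiplicity p x"
proof -
  have "int p ^ n dvd int x \<longleftrightarrow> p ^ n dvd x" for n by (simp flip: of_nat_power)
  then show ?thesis by (simp add: multiplicity_def)
qed

lemma fact_split_off: "k < n \<Longrightarrow> fact n = (\<Prod>i\<le>k. n - i) * (fact (n - Suc k) :: nat)"
proof (induction k)
  case 0
  then show ?case by (cases n) auto
next
  case (Suc k)
  have "fact (n - Suc k) = (n - Suc k) * (fact (n - Suc (Suc k)) :: nat)"
    using Suc.prems by (metis Suc_diff_Suc fact_Suc of_nat_id)
  then show ?case using Suc by simp
qed

text \<open>The closed form of c_j with its denominator cleared, so that valuations can be read off
  from products. The two sides are compared after multiplication by (n-k-1)!.\<close>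

lemma abs_c_coeff:
  assumes "j \<le> k" "k < n"
  shows "\<bar>c_coeff n k j\<bar> * int (fact j * fact (k - j) * (n - j)) = int (\<Prod>i\<le>k. n - i)"
proof -
  let ?B = "n choose j" and ?C = "(n - j - 1) choose (k - j)"
  have 1: "fact j * fact (n - j) * ?B = fact n" using assms by (intro binomial_fact_lemma) simp
  have "fact (k - j) * fact (n - j - 1 - (k - j)) * ?C = fact (n - j - 1)"
    using assms by (intro binomial_fact_lemma) simp
  moreover have "n - j - 1 - (k - j) = n - Suc k" using assms by simp
  ultimately have 2: "fact (k - j) * fact (n - Suc k) * ?C = fact (n - j - 1)" by simp
  have 3: "fact (n - j) = (n - j) * (fact (n - j - 1) :: nat)"
    using assms by (metis One_nat_def Suc_pred fact_Suc of_nat_id zero_less_diff le_less_trans)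
  have "fact (n - Suc k) * (?B * ?C * (fact j * fact (k - j) * (n - j))) =
      fact j * ((n - j) * (fact (k - j) * fact (n - Suc k) * ?C)) * ?B"
    by (simp only: mult_ac)
  also have "\<dots> = fact n" unfolding 2 3[symmetric] 1 ..
  also have "\<dots> = fact (n - Suc k) * (\<Prod>i\<le>k. n - i)"
    using fact_split_off[OF assms(2)] by (simp only: mult.commute)
  finally have "?B * ?C * (fact j * fact (k - j) * (n - j)) = (\<Prod>i\<le>k. n - i)"
    by (simp only: mult_cancel1) simp
  then have "int (?B * ?C) * int (fact j * fact (k - j) * (n - j)) = int (\<Prod>i\<le>k. n - i)"
    by (simp only: of_nat_mult[symmetric])
  moreover have "\<bar>c_coeff n k j\<bar> = int (?B * ?C)"
    by (simp add: c_coeff_def abs_mult power_abs)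
  ultimately show ?thesis by simp
qed

lemma prime_gt_dvd_diff_unique:
  fixes p n k :: nat
  assumes "p dvd n - l" "p dvd n - i" "l \<le> k" "i \<le> k" "k < p" "k \<le> n"
  shows "i = l"
proof -
  have "int p dvd int (n - l) - int (n - i)"
    using assms(1,2) by (intro dvd_diff) (simp_all only: int_dvd_int_iff)
  then have d: "int p dvd int i - int l" using assms by (simp add: of_nat_diff)
  show ?thesis
  proof (rule ccontr)
    assume "i \<noteq> l"
    then have "\<bar>int p\<bar> \<le> \<bar>int i - int l\<bar>" using d by (intro dvd_imp_le_int) auto
    then show False using assms by linarith
  qed
qed

lemma multiplicity_prod_diff:
  fixes p n k :: nat
  assumes p: "prime p" "k < p" and l: "l \<le> k" "p dvd n - l" and n: "k < n"
  shows "multiplicity p (\<Prod>i\<le>k. n - i) = multiplicity p (n - l)"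
proof -
  have "multiplicity p (\<Prod>i\<le>k. n - i) = (\<Sum>i\<le>k. multiplicity p (n - i))"
    using p n by (intro prime_elem_multiplicity_prod_distrib) auto
  also have "\<dots> = (\<Sum>i\<in>{l}. multiplicity p (n - i))"
  proof (intro sum.mono_neutral_right ballI)
    fix i assume "i \<in> {..k} - {l}"
    then have "\<not> p dvd n - i" using prime_gt_dvd_diff_unique[of p n l i k] l p n by auto
    then show "multiplicity p (n - i) = 0" by (rule not_dvd_imp_multiplicity_0)
  qed (use l in auto)
  finally show ?thesis by simp
qed

text \<open>A prime above k divides neither j! nor (k-j)!, and among n, ..., n-k it divides only n -
  l. So the valuation of c_j is that of n - l minus that of n - j.\<close>

lemma multiplicity_c_coeff:
  fixes p n k :: nat
  assumes p: "prime p" "k < p" and l: "l \<le> k" "p dvd n - l" and n: "k < n" and j: "j \<le> k"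
  shows "multiplicity (int p) (c_coeff n k j) = (if j = l then 0 else multiplicity p (n - l))"
proof -
  have pp: "prime (int p)" using p by simp
  have pos: "0 < (\<Prod>i\<le>k. n - i)" using n by (intro prod_pos) auto
  note c = abs_c_coeff[OF j n]
  have nz: "c_coeff n k j \<noteq> 0" using c pos by (metis abs_zero less_irrefl mult_zero_left of_nat_eq_0_iff)
  have nf: "\<not> p dvd fact j" "\<not> p dvd fact (k - j)"
    using p j by (simp_all add: prime_dvd_fact_iff)
  have "multiplicity (int p) (int (\<Prod>i\<le>k. n - i)) =
      multiplicity (int p) \<bar>c_coeff n k j\<bar> + multiplicity (int p) (int (fact j * fact (k - j) * (n - j)))"
    unfolding c[symmetric] using nz n j pp
    by (intro prime_elem_multiplicity_mult_distrib) auto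
  also have "multiplicity (int p) \<bar>c_coeff n k j\<bar> = multiplicity (int p) (c_coeff n k j)"
    by (metis multiplicity_normalize_right normalize_int_def)
  also have "multiplicity (int p) (int (fact j * fact (k - j) * (n - j))) = multiplicity p (n - j)"
    unfolding multiplicity_int_int using p n j nf
    by (simp add: prime_elem_multiplicity_mult_distrib not_dvd_imp_multiplicity_0)
  finally have eq: "multiplicity p (n - l) = multiplicity (int p) (c_coeff n k j) + multiplicity p (n - j)"
    unfolding multiplicity_int_int multiplicity_prod_diff[OF p l n] .
  show "multiplicity (int p) (c_coeff n k j) = (if j = l then 0 else multiplicity p (n - l))"
  proof (cases "j = l")
    case False
    then have "\<not> p dvd n - j" using prime_gt_dvd_diff_unique[of p n l j k] l p n j by auto
    then show ?thesis using eq False by (simp add: not_dvd_imp_multiplicity_0)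
  qed (use eq in simp)
qed

section \<open>From a rational factorization to constraints on the degree of a factor\<close>

text \<open>An arbitrary integral multiple suffices for Newton polygons: a constant raises all
  valuations equally and leaves slopes and horizontal lengths unchanged.\<close>

lemma rat_poly_clear_denominators:
  fixes g :: "rat poly"
  shows "\<exists>d G. d \<noteq> 0 \<and> map_poly of_int G = smult (of_int d) g"
proof (induction g)
  case 0
  show ?case by (rule exI[of _ 1], rule exI[of _ 0]) simp
next
  case (pCons c g)
  then obtain d G where d: "d \<noteq> 0" "map_poly of_int G = smult (of_int d) g" by blast
  obtain x y where q: "quotient_of c = (x, y)" by fastforce
  have c: "c = of_int x / of_int y" "y \<noteq> 0"
    using quotient_of_div[OF q] quotient_of_denom_pos[OF q] by auto
  have "map_poly of_int (pCons (x * d) (smult y G)) = smult (of_int (d * y)) (pCons c g)"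
  proof (rule poly_eqI)
    fix m
    have "of_int (coeff G m) = of_int d * coeff g m" for m
      using arg_cong[OF d(2), of "\<lambda>q. coeff q m"] by (simp add: coeff_map_poly)
    then show "coeff (map_poly of_int (pCons (x * d) (smult y G))) m =
        coeff (smult (of_int (d * y)) (pCons c g)) m"
      using c by (cases m) (simp_all add: coeff_map_poly coeff_pCons)
  qed
  moreover have "d * y \<noteq> 0" using d c by simp
  ultimately show ?case by blast
qed

lemma map_poly_of_int_mult:
  "map_poly (of_int :: int \<Rightarrow> rat) (G * H) = map_poly of_int G * map_poly of_int H"
  by (rule poly_eqI) (simp add: coeff_map_poly coeff_mult)

lemma c_coeff_nonzero: "j \<le> k \<Longrightarrow> k < n \<Longrightarrow> c_coeff n k j \<noteq> 0"
  by (simp add: c_coeff_def)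

lemma coeff_F_poly: "coeff (F_poly n k a) j = (if j \<le> k then of_int (a j * c_coeff n k j) else 0)"
  by (simp add: F_poly_def coeff_sum coeff_monom)

text \<open>The conclusion of \<open>newton_polygon_degree\<close> with e the multiplicity of p in n
  - l, imposed for all primes above k at once.\<close>

definition newton_compatible :: "nat \<Rightarrow> nat \<Rightarrow> nat \<Rightarrow> bool" where
  "newton_compatible n k r \<longleftrightarrow> (\<forall>l p. l \<le> k \<longrightarrow> prime p \<longrightarrow> k < p \<longrightarrow> p dvd n - l \<longrightarrow>
     (\<exists>i i'. r = i + i' \<and> i \<le> l \<and> i' \<le> k - l \<and>
        l dvd multiplicity p (n - l) * i \<and> (k - l) dvd multiplicity p (n - l) * i'))"

lemma factor_newton_compatible:
  fixes g h :: "rat poly"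
  assumes k: "k < n" and a0: "\<And>j. j \<le> k \<Longrightarrow> a j \<noteq> 0"
    and smooth: "\<And>j p. j \<le> k \<Longrightarrow> prime p \<Longrightarrow> p dvd a j \<Longrightarrow> p \<le> int k"
    and gh: "F_poly n k a = g * h"
  shows "newton_compatible n k (degree g)"
  unfolding newton_compatible_def
proof (intro allI impI)
  fix l p assume l: "l \<le> k" and p: "prime p" "k < p" "p dvd n - l"
  obtain d1 G where G: "d1 \<noteq> 0" "map_poly of_int G = smult (of_int d1) g"
    using rat_poly_clear_denominators by blast
  obtain d2 H where H: "d2 \<noteq> 0" "map_poly of_int H = smult (of_int d2) h"
    using rat_poly_clear_denominators by blast
  define d where "d = d1 * d2"
  have d: "d \<noteq> 0" using G H by (simp add: d_def)
  define F where "F = G * H"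
  have "map_poly (of_int :: int \<Rightarrow> rat) F = smult (of_int d) (F_poly n k a)"
    by (simp add: F_def map_poly_of_int_mult G H gh d_def mult_ac)
  then have "coeff (map_poly (of_int :: int \<Rightarrow> rat) F) j = of_int (d * (if j \<le> k then a j * c_coeff n k j else 0))" for j
    by (simp add: coeff_F_poly)
  then have cF: "coeff F j = d * (if j \<le> k then a j * c_coeff n k j else 0)" for j
    by (simp only: coeff_map_poly of_int_0 of_int_eq_iff)
  have nz: "coeff F j \<noteq> 0" if "j \<le> k" for j
    using that d a0 c_coeff_nonzero[OF that k] by (simp add: cF)
  have "degree F = k"
    by (rule antisym, rule degree_le) (use nz[of k] in \<open>auto simp: cF intro!: le_degree\<close>)
  have pp: "prime (int p)" using p by simp
  have val: "multiplicity (int p) (coeff F j) =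
      (if j = l then multiplicity (int p) d else multiplicity (int p) d + multiplicity p (n - l))"
    if j: "j \<le> k" for j
  proof -
    have "\<not> int p dvd a j" using smooth[OF j pp] p by auto
    then have "multiplicity (int p) (a j) = 0" by (rule not_dvd_imp_multiplicity_0)
    moreover have "multiplicity (int p) (coeff F j) =
        multiplicity (int p) d + (multiplicity (int p) (a j) + multiplicity (int p) (c_coeff n k j))"
      using d a0[OF j] c_coeff_nonzero[OF j k] j pp
      by (simp add: cF prime_elem_multiplicity_mult_distrib)
    ultimately show ?thesis using multiplicity_c_coeff(1)[OF p(1,2) l p(3) k j] by simp
  qed
  have e: "multiplicity p (n - l) > 0"
    using p k l by (simp add: prime_multiplicity_gt_zero_iff)
  have dG: "degree G = degree g"
  proof -
    have "degree (map_poly (of_int :: int \<Rightarrow> rat) G) = degree G" by (intro degree_map_poly) auto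
    then show ?thesis using G by simp
  qed
  show "\<exists>i i'. degree g = i + i' \<and> i \<le> l \<and> i' \<le> k - l \<and>
      l dvd multiplicity p (n - l) * i \<and> (k - l) dvd multiplicity p (n - l) * i'"
    using newton_polygon_degree[OF F_def pp e l \<open>degree F = k\<close> nz val] by (simp add: dG)
qed

text \<open>Over a field a nonzero nonunit has positive degree, and both cofactors are subject to
  the constraints, so the one of degree at most k/2 can be taken.\<close>

lemma reducible_newton_compatible:
  assumes k: "0 < k" "k < n" and a0: "\<And>j. j \<le> k \<Longrightarrow> a j \<noteq> 0"
    and smooth: "\<And>j p. j \<le> k \<Longrightarrow> prime p \<Longrightarrow> p dvd a j \<Longrightarrow> p \<le> int k"
    and red: "\<not> irreducible (F_poly n k a)"
  shows "\<exists>r\<ge>1. 2 * r \<le> k \<and> newton_compatible n k r"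
proof -
  let ?F = "F_poly n k a"
  have ck: "coeff ?F k \<noteq> 0" using a0[of k] c_coeff_nonzero[of k k n] k by (simp add: coeff_F_poly)
  then have F0: "?F \<noteq> 0" by auto
  have "degree ?F = k"
    by (rule antisym, rule degree_le) (use ck in \<open>auto simp: coeff_F_poly intro!: le_degree\<close>)
  then have "\<not> ?F dvd 1" using k F0 by (simp add: is_unit_iff_degree)
  then obtain g h where gh: "?F = g * h" "\<not> g dvd 1" "\<not> h dvd 1"
    using red F0 unfolding irreducible_def by blast
  then have g0: "g \<noteq> 0" "h \<noteq> 0" using F0 by auto
  then have dg: "degree g \<ge> 1" "degree h \<ge> 1"
    using gh is_unit_iff_degree[of g] is_unit_iff_degree[of h] by auto
  have dk: "degree g + degree h = k"
    using \<open>degree ?F = k\<close> g0 unfolding gh(1) by (simp add: degree_mult_eq)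
  have hg: "?F = h * g" using gh by (simp add: mult.commute)
  show ?thesis
  proof (cases "2 * degree g \<le> k")
    case True
    have "newton_compatible n k (degree g)"
      using k(2) a0 smooth gh(1) by (rule factor_newton_compatible)
    then show ?thesis using True dg by blast
  next
    case False
    then have "2 * degree h \<le> k" using dk by linarith
    moreover have "newton_compatible n k (degree h)"
      using k(2) a0 smooth hg by (rule factor_newton_compatible)
    ultimately show ?thesis using dg by blast
  qed
qed

text \<open>For multiplicity 1 no edge has an interior lattice point: each share is 0 or the full
  edge, and 0 < r < k rules out taking none or both.\<close>

lemma newton_compatible_simple:
  assumes "newton_compatible n k r" "1 \<le> r" "2 * r \<le> k"
    and "l \<le> k" "prime p" "k < p" "p dvd n - l" "\<not> p\<^sup>2 dvd n - l" "k < n"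
  shows "l = r \<or> l = k - r"
proof -
  have "multiplicity p (n - l) = 1"
    using assms by (intro multiplicity_eqI) (auto simp: power2_eq_square)
  then obtain i i' where i: "r = i + i'" "i \<le> l" "i' \<le> k - l" "l dvd i" "k - l dvd i'"
    using assms(1)[unfolded newton_compatible_def, rule_format, OF assms(4-7)] by auto
  then have "i = 0 \<or> i = l" "i' = 0 \<or> i' = k - l" by (auto dest!: dvd_imp_le)
  then show ?thesis using i(1) assms by auto
qed

lemma dvd_double_le: "(l::nat) dvd 2 * i \<Longrightarrow> i \<le> l \<Longrightarrow> i = 0 \<or> 2 * i = l \<or> i = l"
proof -
  assume "l dvd 2 * i" "i \<le> l"
  then obtain c where c: "2 * i = l * c" by auto
  show ?thesis
  proof (cases "l = 0")
    case False
    have "l * c \<le> l * 2" using c \<open>i \<le> l\<close> by linarith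
    then have "c \<le> 2" using False by (metis mult_le_cancel1 neq0_conv)
    then have "c = 0 \<or> c = 1 \<or> c = 2" by linarith
    then show ?thesis using c by auto
  qed (use \<open>i \<le> l\<close> in simp)
qed

text \<open>For multiplicity 2 an edge may also be halved. One halved edge gives l = 2r or k - l =
  2r; two halved edges give r = k/2 and an even l.\<close>

lemma newton_compatible_square:
  assumes "newton_compatible n k r" "1 \<le> r" "2 * r \<le> k"
    and "l \<le> k" "prime p" "k < p" "p\<^sup>2 dvd n - l" "n < (k + 1) ^ 3" "k < n"
  shows "l \<in> {r, k - r, 2 * r, k - 2 * r} \<or> 2 * r = k \<and> even l"
proof -
  \<comment> \<open>The only use of n < (k+1)^3 here: p >= k+1, so p^3 exceeds n.\<close>
  have "\<not> p ^ 3 dvd n - l"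
  proof
    assume "p ^ 3 dvd n - l"
    then have "p ^ 3 \<le> n - l" using assms by (intro dvd_imp_le) auto
    moreover have "(k + 1) ^ 3 \<le> p ^ 3" using assms by (intro power_mono) auto
    ultimately show False using assms by linarith
  qed
  then have "multiplicity p (n - l) = 2"
    using assms by (intro multiplicity_eqI) (auto simp: numeral_3_eq_3)
  moreover have pd: "p dvd n - l" using assms(7) by (auto simp: power2_eq_square intro: dvd_mult_left)
  ultimately obtain i i' where i: "r = i + i'" "i \<le> l" "i' \<le> k - l" "l dvd 2 * i" "k - l dvd 2 * i'"
    using assms(1)[unfolded newton_compatible_def, rule_format, OF assms(4-6) pd] by auto
  then have "i = 0 \<or> 2 * i = l \<or> i = l" "i' = 0 \<or> 2 * i' = k - l \<or> i' = k - l"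
    using dvd_double_le by blast+
  moreover have "even l" if "2 * i = l" using that by auto
  moreover obtain j where j: "k = l + j" using assms(4) le_Suc_ex by blast
  ultimately have "l = r \<or> j = r \<or> l = 2 * r \<or> j = 2 * r \<or> 2 * r = k \<and> even l"
    using i(1) assms(2,3) by (cases "2 * i = l"; cases "2 * i' = j") auto
  then show ?thesis using j by auto
qed

section \<open>Products of smooth numbers\<close>

text \<open>The product of the distances to \<open>x0\<close> is x0! (m-x0)!, and the quotient is a
  binomial coefficient. With truncated subtraction \<open>(x - x0) + (x0 - x)\<close> is the
  absolute difference.\<close>

lemma prod_distance_dvd_fact:
  fixes x0 m :: nat
  assumes "x0 \<le> m"
  shows "(\<Prod>x\<in>{..m} - {x0}. (x - x0) + (x0 - x)) dvd (fact m :: nat)"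
proof -
  have "(\<Prod>x\<in>{..m} - {x0}. (x - x0) + (x0 - x)) =
      (\<Prod>x\<in>{..<x0} \<union> {Suc x0..m}. (x - x0) + (x0 - x))"
    using assms by (intro prod.cong) auto
  also have "\<dots> = (\<Prod>x\<in>{..<x0}. (x - x0) + (x0 - x)) * (\<Prod>x\<in>{Suc x0..m}. (x - x0) + (x0 - x))"
    by (intro prod.union_disjoint) auto
  also have "(\<Prod>x\<in>{..<x0}. (x - x0) + (x0 - x)) = (\<Prod>x\<in>{..<x0}. x0 - x)"
    by (intro prod.cong) auto
  also have "\<dots> = fact x0" by (simp add: fact_prod_rev atLeast0LessThan)
  also have "(\<Prod>x\<in>{Suc x0..m}. (x - x0) + (x0 - x)) = (\<Prod>x\<in>{1..m - x0}. x)"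
    using assms by (intro prod.reindex_bij_witness[of _ "\<lambda>x. x + x0" "\<lambda>x. x - x0"]) auto
  also have "\<dots> = fact (m - x0)" by (simp add: fact_prod)
  also have "fact x0 * fact (m - x0) dvd (fact m :: nat)" 
    using binomial_fact_lemma[OF assms] by (metis dvd_triv_left)
  finally show ?thesis .
qed

text \<open>Maximality at \<open>x0\<close> makes the p-part of f x divide f x0 as well, hence also
  the distance of x and x0. Stating this through \<open>compat\<close>, instead of fixing f x = n -
  x, lets the argument run over odd numbers and over halves too.\<close>

lemma valuation_deletion:
  fixes f :: "nat \<Rightarrow> nat"
  assumes X: "X \<subseteq> {..m}" and x0: "x0 \<in> X"
    and max: "\<And>x. x \<in> X \<Longrightarrow> multiplicity p (f x) \<le> multiplicity p (f x0)"
    and compat: "\<And>x y j. x \<in> X \<Longrightarrow> y \<in> X \<Longrightarrow> y < x \<Longrightarrow> p ^ j dvd f x \<Longrightarrow> p ^ j dvd f y \<Longrightarrow> p ^ j dvd x - y"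
  shows "p ^ (\<Sum>x\<in>X - {x0}. multiplicity p (f x)) dvd fact m"
proof -
  have fin: "finite X" using X by (rule finite_subset) simp
  have "p ^ (\<Sum>x\<in>X - {x0}. multiplicity p (f x)) = (\<Prod>x\<in>X - {x0}. p ^ multiplicity p (f x))"
    by (simp add: power_sum)
  also have "\<dots> dvd (\<Prod>x\<in>X - {x0}. (x - x0) + (x0 - x))"
  proof (intro prod_dvd_prod)
    fix x assume x: "x \<in> X - {x0}"
    have "p ^ multiplicity p (f x) dvd f x" by (rule multiplicity_dvd)
    moreover have "p ^ multiplicity p (f x) dvd f x0" using max x by (intro multiplicity_dvd') auto
    moreover have "x < x0 \<or> x0 < x" using x by auto
    ultimately show "p ^ multiplicity p (f x) dvd (x - x0) + (x0 - x)"
      using compat[of x x0] compat[of x0 x] x x0 by auto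
  qed
  also have "\<dots> dvd (\<Prod>x\<in>{..m} - {x0}. (x - x0) + (x0 - x))"
    using X by (intro prod_dvd_prod_subset) auto
  also have "\<dots> dvd fact m" using X x0 by (intro prod_distance_dvd_fact) auto
  finally show ?thesis .
qed

text \<open>One index \<open>g p\<close> is deleted for each prime in \<open>P\<close>; deletions
  may coincide, so at least \<open>card X - card P\<close> indices remain. Prime by prime the
  remaining product divides m!. If there are too few indices, truncated subtraction makes the bound
  trivial.\<close>

lemma deletion_bound:
  fixes f :: "nat \<Rightarrow> nat"
  assumes X: "X \<subseteq> {..m}" and P: "finite P" "\<And>p. p \<in> P \<Longrightarrow> prime p"
    and smooth: "\<And>x p. x \<in> X \<Longrightarrow> prime p \<Longrightarrow> p dvd f x \<Longrightarrow> p \<in> P"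
    and pos: "\<And>x. x \<in> X \<Longrightarrow> 0 < f x"
    and compat: "\<And>p x y j. p \<in> P \<Longrightarrow> x \<in> X \<Longrightarrow> y \<in> X \<Longrightarrow> y < x \<Longrightarrow>
      p ^ j dvd f x \<Longrightarrow> p ^ j dvd f y \<Longrightarrow> p ^ j dvd x - y"
    and B: "\<And>x. x \<in> X \<Longrightarrow> B \<le> f x"
  shows "B ^ (card X - card P) \<le> fact m"
proof (cases "X = {} \<or> B = 0")
  case True
  then show ?thesis by (auto simp: power_0_left)
next
  case False
  then have ne: "X \<noteq> {}" and B1: "B \<ge> 1" by auto
  have fin: "finite X" using X by (rule finite_subset) simp
  have "\<exists>x0\<in>X. \<forall>x\<in>X. multiplicity p (f x) \<le> multiplicity p (f x0)" for p
  proof -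
    have "Max ((\<lambda>x. multiplicity p (f x)) ` X) \<in> (\<lambda>x. multiplicity p (f x)) ` X"
      using fin ne by (intro Max_in) auto
    then obtain x0 where x0: "x0 \<in> X" "Max ((\<lambda>x. multiplicity p (f x)) ` X) = multiplicity p (f x0)"
      by auto
    then show ?thesis using Max_ge[of "(\<lambda>x. multiplicity p (f x)) ` X"] fin
      by (metis finite_imageI imageI)
  qed
  then obtain g where g: "\<And>p. g p \<in> X"
      "\<And>p x. x \<in> X \<Longrightarrow> multiplicity p (f x) \<le> multiplicity p (f (g p))"
    by metis
  define Y where "Y = X - g ` P"
  have finY: "finite Y" using fin by (simp add: Y_def)
  have "card X - card P \<le> card X - card (g ` P)" using card_image_le[OF P(1), of g] by simp
  also have "\<dots> \<le> card Y" unfolding Y_def using P by (intro diff_card_le_card_Diff) auto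
  finally have cY: "card X - card P \<le> card Y" .
  have posY: "(\<Prod>y\<in>Y. f y) \<noteq> 0" using finY pos by (auto simp: Y_def)
  have "(\<Prod>y\<in>Y. f y) dvd fact m"
  proof (rule multiplicity_le_imp_dvd[OF posY])
    fix p :: nat assume p: "prime p"
    have eq: "multiplicity p (\<Prod>y\<in>Y. f y) = (\<Sum>y\<in>Y. multiplicity p (f y))"
      using p posY finY by (intro prime_elem_multiplicity_prod_distrib) auto
    show "multiplicity p (\<Prod>y\<in>Y. f y) \<le> multiplicity p (fact m)"
    proof (cases "p \<in> P")
      case True
      have "(\<Sum>y\<in>Y. multiplicity p (f y)) \<le> (\<Sum>y\<in>X - {g p}. multiplicity p (f y))"
        using True fin by (intro sum_mono2) (auto simp: Y_def)
      moreover have "p ^ (\<Sum>y\<in>X - {g p}. multiplicity p (f y)) dvd fact m"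
        using X g compat[OF True] by (intro valuation_deletion) auto
      then have "(\<Sum>y\<in>X - {g p}. multiplicity p (f y)) \<le> multiplicity p (fact m)"
        using p by (intro multiplicity_geI) (auto simp: prime_elem_not_unit)
      ultimately show ?thesis using eq by simp
    next
      case False
      then have "multiplicity p (f y) = 0" if "y \<in> Y" for y
        using smooth[of y p] p that by (intro not_dvd_imp_multiplicity_0) (auto simp: Y_def)
      then show ?thesis using eq by simp
    qed
  qed
  then have le: "(\<Prod>y\<in>Y. f y) \<le> fact m" by (intro dvd_imp_le) auto
  have "B ^ (card X - card P) \<le> B ^ card Y" using cY B1 by (rule power_increasing)
  also have "\<dots> = (\<Prod>y\<in>Y. B)" by simp
  also have "\<dots> \<le> (\<Prod>y\<in>Y. f y)" using B by (intro prod_mono) (auto simp: Y_def)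
  finally show ?thesis using le by simp
qed

definition prime_count :: "nat \<Rightarrow> nat" where
  "prime_count k = card {p. prime p \<and> p \<le> k}"

definition smooth_nat :: "nat \<Rightarrow> nat \<Rightarrow> bool" where
  "smooth_nat k x \<longleftrightarrow> (\<forall>p. prime p \<longrightarrow> p dvd x \<longrightarrow> p \<le> k)"

lemma finite_primes_le [simp]: "finite {p::nat. prime p \<and> p \<le> k}"
  by (rule finite_subset[of _ "{..k}"]) auto

lemma smooth_run_bound:
  fixes n k :: nat
  assumes L: "L \<subseteq> {..k}" and n: "k < n" and smooth: "\<And>l. l \<in> L \<Longrightarrow> smooth_nat k (n - l)"
  shows "(n - k) ^ (card L - prime_count k) \<le> fact k"
  unfolding prime_count_def
proof (rule deletion_bound[where f = "\<lambda>l. n - l"])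
  show "L \<subseteq> {..k}" by fact
  show "\<And>x. x \<in> L \<Longrightarrow> 0 < n - x" using L n by auto
  show "\<And>x. x \<in> L \<Longrightarrow> n - k \<le> n - x" using L by auto
  fix p x y j assume xy: "x \<in> L" "y \<in> L" "y < x" and d: "p ^ j dvd n - x" "p ^ j dvd n - y"
  have "x - y = (n - y) - (n - x)" using xy L n by auto
  then show "p ^ j dvd x - y" using d by (simp only: dvd_diff_nat)
qed (use smooth in \<open>auto simp: smooth_nat_def\<close>)

text \<open>For \<open>n = 2 * N + 1\<close> the terms \<open>n - l\<close> with \<open>l\<close> odd are the doubles of consecutive numbers; for
  \<open>n = 2 * N\<close> they are odd, so the prime 2 need not be discarded.\<close>

lemma smooth_odd_run_bound_odd:
  fixes N k M :: nat
  assumes k: "k = 2 * M" "0 < M" and L: "L \<subseteq> {..<M}" and n: "k < 2 * N"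
    and smooth: "\<And>i. i \<in> L \<Longrightarrow> smooth_nat k (2 * N + 1 - (2 * i + 1))"
  shows "(N - M) ^ (card L - prime_count k) \<le> fact (M - 1)"
  unfolding prime_count_def
proof (rule deletion_bound[where f = "\<lambda>i. N - i"])
  \<comment> \<open>The run is indexed by i, not by l = 2i + 1, so the factorial is that of M - 1
    instead of k.\<close>
  show "L \<subseteq> {..M - 1}" using L by auto
  show "\<And>x. x \<in> L \<Longrightarrow> 0 < N - x" using L n k by force
  show "\<And>x. x \<in> L \<Longrightarrow> N - M \<le> N - x" using L by force
  show "p \<in> {p. prime p \<and> p \<le> k}" if "x \<in> L" "prime p" "p dvd N - x" for x p
  proof -
    have "2 * N + 1 - (2 * x + 1) = 2 * (N - x)" by simp
    then have "p dvd 2 * N + 1 - (2 * x + 1)" using that by (simp del: diff_diff_left)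
    then show ?thesis using smooth that by (auto simp: smooth_nat_def)
  qed
  fix p x y j assume xy: "x \<in> L" "y \<in> L" "y < x" and d: "p ^ j dvd N - x" "p ^ j dvd N - y"
  have "x - y = (N - y) - (N - x)" using xy L n k by force
  then show "p ^ j dvd x - y" using d by (simp only: dvd_diff_nat)
qed auto

lemma smooth_odd_run_bound_even:
  fixes N k M :: nat
  assumes k: "k = 2 * M" "0 < M" and L: "L \<subseteq> {..<M}" and n: "k < 2 * N"
    and smooth: "\<And>i. i \<in> L \<Longrightarrow> smooth_nat k (2 * N - (2 * i + 1))"
  shows "(2 * N - k) ^ (card L - (prime_count k - 1)) \<le> fact (M - 1)"
proof -
  let ?P = "{p. prime p \<and> p \<le> k} - {2}"
  have "card ?P = prime_count k - 1"
    unfolding prime_count_def using k by (subst card_Diff_singleton) auto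
  moreover have "(2 * N - k) ^ (card L - card ?P) \<le> fact (M - 1)"
  proof (rule deletion_bound[where f = "\<lambda>i. 2 * N - (2 * i + 1)"])
    show "L \<subseteq> {..M - 1}" using L by auto
    show "\<And>x. x \<in> L \<Longrightarrow> 0 < 2 * N - (2 * x + 1)" using L n k by force
    show "\<And>x. x \<in> L \<Longrightarrow> 2 * N - k \<le> 2 * N - (2 * x + 1)" using L k by force
    show "p \<in> ?P" if "x \<in> L" "prime p" "p dvd 2 * N - (2 * x + 1)" for x p
    proof -
      have "x < M" using L that by auto
      then have "x < N" using n k by linarith
      then have "odd (2 * N - (2 * x + 1))" by simp
      then have "p \<noteq> 2" using that by blast
      then show ?thesis using smooth that by (auto simp: smooth_nat_def)
    qed
    fix p x y j assume p: "p \<in> ?P" and xy: "x \<in> L" "y \<in> L" "y < x"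
      and d: "p ^ j dvd 2 * N - (2 * x + 1)" "p ^ j dvd 2 * N - (2 * y + 1)"
    have "x < M" using L xy by auto
    then have "x < N" using n k by linarith
    then obtain u v where "N = x + u" "u > 0" "x = y + v" using xy
      by (metis less_imp_add_positive)
    \<comment> \<open>The odd numbers differ by twice the difference of their indices; the factor 2
      cancels because p is odd.\<close>
    then have "(x - y) * 2 = (2 * N - (2 * y + 1)) - (2 * N - (2 * x + 1))" by simp
    then have "p ^ j dvd (x - y) * 2" using d by (simp only: dvd_diff_nat)
    moreover have "coprime (p ^ j) 2" using p primes_coprime[of p 2] by simp
    ultimately show "p ^ j dvd x - y" by (simp only: coprime_dvd_mult_left_iff)
  qed auto
  ultimately show ?thesis by simp
qed

section \<open>Prime counting\<close>

text \<open>All primes below 223, the next prime. They are integers because the evaluated checks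
  compute in \<open>int\<close>.\<close>

definition small_primes :: "int list" where
  "small_primes = [2,3,5,7,11,13,17,19,23,29,31,37,41,43,47,53,59,61,67,71,73,79,83,89,97,101,103,107,
     109,113,127,131,137,139,149,151,157,163,167,173,179,181,191,193,197,199,211]"

text \<open>A composite number up to 222 < 17^2 has a prime divisor at most 13.\<close>

lemma prime_in_small_primes:
  assumes "prime p" "p \<le> (222::nat)"
  shows "int p \<in> set small_primes"
proof (rule ccontr)
  assume np: "int p \<notin> set small_primes"
  have "list_all (\<lambda>j. j \<notin> set small_primes \<longrightarrow> list_ex (\<lambda>d. j mod d = 0 \<and> 1 < d \<and> d < j) [2,3,5,7,11,13]) [2..222]"
    by code_simp
  moreover have "int p \<in> set [2..222]"
    unfolding set_upto using assms prime_ge_2_nat[of p] by auto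
  ultimately have "int p \<notin> set small_primes \<longrightarrow> list_ex (\<lambda>d. int p mod d = 0 \<and> 1 < d \<and> d < int p) [2,3,5,7,11,13]"
    unfolding list_all_iff by (rule bspec)
  then have "\<exists>d\<in>set [2,3,5,7,11,13]. int p mod d = 0 \<and> 1 < d \<and> d < int p"
    using np unfolding list_ex_iff by (rule mp)
  then obtain d where d: "int p mod d = 0" "1 < d" "d < int p" by (elim bexE conjE)
  then have "d dvd int p" "0 \<le> d" by auto
  moreover have "prime (int p)" using assms by simp
  ultimately have "d = 1 \<or> d = int p" unfolding prime_int_iff by blast
  then show False using d by simp
qed

lemma prime_count_small:
  assumes "s \<le> 222"
  shows "prime_count s \<le> length (filter (\<lambda>p. p \<le> int s) small_primes)"
proof -
  have "card {p. prime p \<and> p \<le> s} = card (int ` {p. prime p \<and> p \<le> s})"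
    by (simp add: card_image)
  also have "\<dots> \<le> card (set (filter (\<lambda>p. p \<le> int s) small_primes))"
    using assms prime_in_small_primes by (intro card_mono) auto
  also have "\<dots> \<le> length (filter (\<lambda>p. p \<le> int s) small_primes)" by (rule card_length)
  finally show ?thesis by (simp add: prime_count_def)
qed

text \<open>Primes above 7 avoid the factors of 210 = 2 * 3 * 5 * 7, and a window of 210 consecutive
  numbers meets each of the 48 residue classes prime to 210 once.\<close>

lemma prime_count_step:
  assumes "k \<ge> 7"
  shows "prime_count (k + 210) \<le> prime_count k + 48"
proof -
  let ?S = "{p. prime p \<and> k < p \<and> p \<le> k + 210}"
  let ?C = "filter (\<lambda>r. r mod 2 \<noteq> 0 \<and> r mod 3 \<noteq> 0 \<and> r mod 5 \<noteq> 0 \<and> r mod 7 \<noteq> 0) [0..209::int]"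
  have fin: "finite ?S" by (rule finite_subset[of _ "{..k + 210}"]) auto
  have "inj_on (\<lambda>p. int p mod 210) ?S"
  proof (rule inj_onI)
    fix x y assume xy: "x \<in> ?S" "y \<in> ?S" "int x mod 210 = int y mod 210"
    then have d: "210 dvd int x - int y" by (simp only: mod_eq_dvd_iff)
    show "x = y"
    proof (rule ccontr)
      assume "x \<noteq> y"
      then have "\<bar>210\<bar> \<le> \<bar>int x - int y\<bar>" using d by (intro dvd_imp_le_int) auto
      then show False using xy by auto
    qed
  qed
  moreover have "(\<lambda>p. int p mod 210) ` ?S \<subseteq> set ?C"
  proof
    fix z assume "z \<in> (\<lambda>p. int p mod 210) ` ?S"
    then obtain p where p: "z = int p mod 210" "prime p" "k < p" by auto
    have nd: "int p mod d \<noteq> 0" if "1 < d" "d \<le> 7" for d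
    proof
      assume "int p mod d = 0"
      then have "d dvd int p" by auto
      moreover have "prime (int p)" "0 \<le> d" using p that by simp_all
      ultimately have "d = 1 \<or> d = int p" unfolding prime_int_iff by blast
      then show False using that p assms by auto
    qed
    have "z mod 2 = int p mod 2" "z mod 3 = int p mod 3" "z mod 5 = int p mod 5" "z mod 7 = int p mod 7"
      unfolding p(1) by (simp_all add: mod_mod_cancel)
    moreover have "int p mod 2 \<noteq> 0" "int p mod 3 \<noteq> 0" "int p mod 5 \<noteq> 0" "int p mod 7 \<noteq> 0"
      by (rule nd; simp)+
    moreover have "0 \<le> z" "z \<le> 209" using p by auto
    ultimately show "z \<in> set ?C"
      unfolding set_filter set_upto mem_Collect_eq atLeastAtMost_iff by metis
  qed
  ultimately have "card ?S \<le> card (set ?C)" by (rule card_inj_on_le) (rule finite_set)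
  also have "\<dots> \<le> length ?C" by (rule card_length)
  also have "\<dots> = 48" by code_simp
  finally have S: "card ?S \<le> 48" .
  have "{p. prime p \<and> p \<le> k + 210} = {p. prime p \<and> p \<le> k} \<union> ?S" by auto
  then have "prime_count (k + 210) \<le> prime_count k + card ?S"
    unfolding prime_count_def by (metis card_Un_le)
  then show ?thesis using S by simp
qed

text \<open>Steps of 210 cost at most 48 primes, and 4 * 48 < 210; the initial segment is evaluated.
  The constant 13 is attained, for instance at s = 31, 43 and 47.\<close>

lemma prime_count_le: "4 * prime_count s \<le> s + 13"
proof (induction s rule: less_induct)
  case (less s)
  show ?case
  proof (cases "s \<le> 222")
    case True
    have "list_all (\<lambda>s. 4 * int (length (filter (\<lambda>p. p \<le> s) small_primes)) \<le> s + 13) [0..222]"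
      by code_simp
    then have "4 * int (length (filter (\<lambda>p. p \<le> int s) small_primes)) \<le> int s + 13"
      using True unfolding list_all_iff set_upto by simp
    then show ?thesis using prime_count_small[OF True] by linarith
  next
    case False
    then have "prime_count s \<le> prime_count (s - 210) + 48" using prime_count_step[of "s - 210"] by simp
    moreover have "4 * prime_count (s - 210) \<le> (s - 210) + 13" using False by (intro less) auto
    ultimately show ?thesis using False by linarith
  qed
qed

section \<open>Elementary bounds for primorials and factorials\<close>

lemma prod_primes_dvd:
  fixes x :: nat
  assumes "finite A" "\<And>p. p \<in> A \<Longrightarrow> prime p \<and> p dvd x"
  shows "\<Prod>A dvd x"
  using assms
proof (induction A rule: finite_induct)
  case (insert p A)
  have "coprime p (\<Prod>A)"
    using insert by (intro prod_coprime_right) (auto intro!: primes_coprime)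
  then show ?case using insert by (simp add: divides_mult)
qed simp

definition primorial :: "nat \<Rightarrow> nat" where
  "primorial n = \<Prod>{p. prime p \<and> p \<le> n}"

text \<open>Erdos' induction: for n = 2m + 1 the primes in (m+1, n] all divide n choose m, which is
  at most 4^m, and the primes up to m + 1 are handled by induction.\<close>

lemma primorial_le: "primorial n \<le> 4 ^ n"
proof (induction n rule: less_induct)
  case (less n)
  consider "n \<le> 1" | "n = 2" | "n > 2" "even n" | "n > 2" "odd n" by linarith
  then show ?case
  proof cases
    case 1
    then have "{p::nat. prime p \<and> p \<le> n} = {}" by (auto dest: prime_ge_2_nat)
    then show ?thesis unfolding primorial_def by (simp only: prod.empty) simp
  next
    case 2
    have "{p::nat. prime p \<and> p \<le> 2} = {2}" by (auto dest: prime_ge_2_nat)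
    then show ?thesis using 2 by (simp add: primorial_def)
  next
    case 3
    then have "\<not> prime n" using prime_odd_nat by blast
    then have "prime p \<and> p \<le> n \<longleftrightarrow> prime p \<and> p \<le> n - 1" for p
      by (cases "p = n") auto
    then have "{p. prime p \<and> p \<le> n} = {p. prime p \<and> p \<le> n - 1}" by blast
    then have "primorial n = primorial (n - 1)" by (simp add: primorial_def)
    also have "\<dots> \<le> 4 ^ (n - 1)" using 3 by (intro less) auto
    also have "\<dots> \<le> 4 ^ n" by (intro power_increasing) auto
    finally show ?thesis .
  next
    case 4
    then obtain m where m: "n = 2 * m + 1" by (auto elim: oddE)
    let ?A = "{p. prime p \<and> p \<le> m + 1}" and ?B = "{p. prime p \<and> m + 1 < p \<and> p \<le> n}"
    let ?C = "n choose m"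
    have finB: "finite ?B" by (rule finite_subset[of _ "{..n}"]) auto
    have "m + 1 \<le> n" using m 4 by simp
    then have "{p. prime p \<and> p \<le> n} = ?A \<union> ?B" by (auto intro: order_trans)
    then have "primorial n = \<Prod>?A * \<Prod>?B"
      unfolding primorial_def using finB by (simp add: prod.union_disjoint disjoint_iff)
    moreover have "\<Prod>?A \<le> 4 ^ (m + 1)" using less[of "m + 1"] m 4 by (simp add: primorial_def)
    moreover have "\<Prod>?B \<le> 4 ^ m"
    proof -
      have "\<Prod>?B dvd ?C"
      proof (rule prod_primes_dvd[OF finB])
        fix p assume p: "p \<in> ?B"
        have "fact m * fact (n - m) * ?C = fact n" using m by (intro binomial_fact_lemma) simp
        moreover have "p dvd fact n" "\<not> p dvd fact m" "\<not> p dvd fact (n - m)"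
          using p m by (subst prime_dvd_fact_iff; force)+
        ultimately show "prime p \<and> p dvd ?C" using p by (metis mem_Collect_eq prime_dvd_mult_iff)
      qed
      then have "\<Prod>?B \<le> ?C" using m by (intro dvd_imp_le) auto
      moreover have "2 * ?C \<le> 2 * 4 ^ m"
      proof -
        \<comment> \<open>The two central binomial coefficients of the odd row are equal, so each is
          at most half of the row sum 2^n.\<close>
        have "?C + (n choose (m + 1)) = (\<Sum>i\<in>{m, m + 1}. n choose i)" by simp
        also have "\<dots> \<le> (\<Sum>i\<le>n. n choose i)" using m by (intro sum_mono2) auto
        also have "\<dots> = 2 ^ n" by (rule choose_row_sum)
        also have "\<dots> = 2 * 4 ^ m" by (simp add: m power_mult)
        finally show ?thesis using binomial_symmetric[of m n] m by simp
      qed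
      ultimately show ?thesis by simp
    qed
    ultimately have "primorial n \<le> 4 ^ (m + 1) * 4 ^ m" by (simp add: mult_mono)
    then show ?thesis by (simp add: m power_add mult_2)
  qed
qed

text \<open>Stirling's upper bound up to a factor of order sqrt k; the induction step amounts to ln
  (1 + 1/k) >= 1/(k+1).\<close>

lemma ln_fact_le: "k \<ge> 1 \<Longrightarrow> ln (fact k :: real) \<le> 1 + ln k + k * ln k - k"
proof (induction k rule: dec_induct)
  case (step k)
  have k: "real k > 0" using step by simp
  have "ln (real k / (real k + 1)) \<le> real k / (real k + 1) - 1"
    using k by (intro ln_le_minus_one) auto
  also have "\<dots> = - 1 / (real k + 1)" using k by (simp add: field_simps)
  finally have "ln (real k) - ln (real k + 1) \<le> - 1 / (real k + 1)" using k by (simp add: ln_div)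
  then have "(real k + 1) * (ln (real k + 1) - ln (real k)) \<ge> 1" using k by (simp add: field_simps)
  moreover have "ln (fact (Suc k) :: real) = ln (real k + 1) + ln (fact k)"
    using k by (simp add: ln_mult add.commute)
  ultimately show ?case using step by (simp add: algebra_simps)
qed simp

section \<open>Constraints on the degree of a factor\<close>

text \<open>The arithmetic content of a factor of degree r, with the polynomial forgotten. What
  follows shows that these assumptions leave only the four exceptional pairs.\<close>

locale rigid_degree =
  fixes n k r :: nat
  assumes k4: "4 \<le> k" and nk: "2 * k \<le> n" and n3: "n < (k + 1) ^ 3"
    and r1: "1 \<le> r" and r2: "2 * r \<le> k"
    and simple_prime: "\<And>l p. l \<le> k \<Longrightarrow> prime p \<Longrightarrow> k < p \<Longrightarrow> p dvd n - l \<Longrightarrow> \<not> p\<^sup>2 dvd n - l \<Longrightarrow>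
      l = r \<or> l = k - r"
    and square_prime: "\<And>l p. l \<le> k \<Longrightarrow> prime p \<Longrightarrow> k < p \<Longrightarrow> p\<^sup>2 dvd n - l \<Longrightarrow>
      l \<in> {r, k - r, 2 * r, k - 2 * r} \<or> 2 * r = k \<and> even l"
begin

text \<open>Here p^2 >= (k+1)^2 > n, so every prime above k divides a term at most once.\<close>

lemma below_square:
  assumes "n < (k + 1)\<^sup>2" "l \<le> k" "prime p" "k < p" "p dvd n - l"
  shows "l = r \<or> l = k - r"
proof (rule simple_prime)
  show "\<not> p\<^sup>2 dvd n - l"
  proof
    assume "p\<^sup>2 dvd n - l"
    then have "p\<^sup>2 \<le> n - l" using assms nk k4 by (intro dvd_imp_le) auto
    moreover have "(k + 1)\<^sup>2 \<le> p\<^sup>2" using assms by (intro power_mono) auto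
    ultimately show False using assms by linarith
  qed
qed (use assms in auto)

end

section \<open>Prime powers in n choose k, and its size\<close>

lemma choose_mult_fact:
  assumes "k \<le> n"
  shows "(n choose k) * fact k = (\<Prod>i<k. n - i)"
proof (cases k)
  case (Suc m)
  have "fact k * fact (n - k) * (n choose k) = (\<Prod>i\<le>m. n - i) * fact (n - Suc m)"
    using binomial_fact_lemma[OF assms] fact_split_off[of m n] assms Suc by simp
  then have "fact (n - k) * ((n choose k) * fact k) = fact (n - k) * (\<Prod>i<k. n - i)"
    using Suc by (simp add: mult_ac lessThan_Suc_atMost)
  then show ?thesis by (simp only: mult_cancel1) simp
qed simp

lemma multiplicity_choose:
  assumes "k \<le> n" "prime p"
  shows "multiplicity p (n choose k) + multiplicity p (fact k :: nat) = (\<Sum>i<k. multiplicity p (n - i))"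
proof -
  have "multiplicity p (n choose k) + multiplicity p (fact k :: nat) = multiplicity p ((n choose k) * fact k)"
    using assms by (subst prime_elem_multiplicity_mult_distrib) auto
  also have "\<dots> = (\<Sum>i<k. multiplicity p (n - i))"
    unfolding choose_mult_fact[OF assms(1)] using assms
    by (intro prime_elem_multiplicity_prod_distrib) auto
  finally show ?thesis .
qed

text \<open>Once the term n - x0 with the largest p-valuation is removed, the p-part of the other
  terms divides k! and is cancelled by the denominator; at most the p-part of n - x0
  survives.\<close>

lemma prime_power_choose_le:
  fixes p :: nat
  assumes "1 \<le> k" "k \<le> n" "prime p"
  shows "p ^ multiplicity p (n choose k) \<le> n"
proof -
  let ?v = "\<lambda>i. multiplicity p (n - i)"
  have "Max (?v ` {..<k}) \<in> ?v ` {..<k}" using assms by (intro Max_in) (auto simp: lessThan_empty_iff)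
  then obtain x0 where x0: "x0 < k" "Max (?v ` {..<k}) = ?v x0" by auto
  have max: "?v x \<le> ?v x0" if "x < k" for x
    unfolding x0(2)[symmetric] using that by (intro Max_ge) auto
  have "p ^ (\<Sum>x\<in>{..<k} - {x0}. ?v x) dvd fact k"
  proof (rule valuation_deletion)
    fix x y j assume xy: "x \<in> {..<k}" "y \<in> {..<k}" "y < x" "p ^ j dvd n - x" "p ^ j dvd n - y"
    then have "x - y = (n - y) - (n - x)" using assms by auto
    then show "p ^ j dvd x - y" using xy by (simp only: dvd_diff_nat)
  qed (use x0 max in auto)
  then have "(\<Sum>x\<in>{..<k} - {x0}. ?v x) \<le> multiplicity p (fact k :: nat)"
    using assms by (intro multiplicity_geI) (auto simp: prime_elem_not_unit)
  moreover have "(\<Sum>x<k. ?v x) = ?v x0 + (\<Sum>x\<in>{..<k} - {x0}. ?v x)"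
    using x0 by (intro sum.remove) auto
  ultimately have "multiplicity p (n choose k) \<le> ?v x0"
    using multiplicity_choose[OF assms(2,3)] by linarith
  then have "p ^ multiplicity p (n choose k) dvd n - x0" by (rule multiplicity_dvd')
  then have "p ^ multiplicity p (n choose k) \<le> n - x0" using x0 assms by (intro dvd_imp_le) auto
  then show ?thesis by simp
qed

text \<open>The terms n, ..., n-k+1 exceed p and are smaller than 3p, so only 2p can contribute a
  factor p, which k! cancels. For p = 2 the term 2p would contribute two.\<close>

lemma prime_not_dvd_choose:
  fixes p :: nat
  assumes nk: "2 * k \<le> n" and p: "prime p" "p \<le> k" "n < 3 * p" "2 < p"
  shows "\<not> p dvd n choose k"
proof
  assume d: "p dvd n choose k"
  have kn: "k \<le> n" using nk by simp
  have "p dvd fact k" using p by (simp add: prime_dvd_fact_iff)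
  then have "multiplicity p (fact k :: nat) \<ge> 1"
    using p by (metis One_nat_def Suc_leI fact_nonzero prime_imp_prime_elem prime_multiplicity_gt_zero_iff)
  moreover have "multiplicity p (n choose k) \<ge> 1"
    using d p kn by (metis One_nat_def Suc_leI binomial_eq_0_iff leD prime_imp_prime_elem prime_multiplicity_gt_zero_iff)
  ultimately have two: "(\<Sum>i<k. multiplicity p (n - i)) \<ge> 2"
    using multiplicity_choose[OF kn p(1)] by linarith
  have zero: "multiplicity p (n - i) = 0" if i: "i < k" "i \<noteq> n - 2 * p" for i
  proof (rule not_dvd_imp_multiplicity_0)
    show "\<not> p dvd n - i"
    proof
      assume "p dvd n - i"
      then obtain c where c: "n - i = p * c" by auto
      have "n - i > 0" "n - i \<noteq> p" using i nk p by linarith+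
      then have "c \<noteq> 0" "c \<noteq> 1" using c by auto
      moreover have "c < 3"
      proof (rule ccontr)
        assume "\<not> c < 3"
        then have "p * 3 \<le> p * c" by simp
        then show False using c p by linarith
      qed
      ultimately have "c = 2" by linarith
      then have "n - i = 2 * p" using c by simp
      then show False using i nk by linarith
    qed
  qed
  have "(\<Sum>i<k. multiplicity p (n - i)) = (\<Sum>i\<in>{..<k} \<inter> {n - 2 * p}. multiplicity p (n - i))"
    using zero by (intro sum.mono_neutral_right) auto
  also have "\<dots> \<le> (\<Sum>i\<in>{n - 2 * p}. multiplicity p (n - i))" by (intro sum_mono2) auto
  also have "\<dots> = multiplicity p (2 * p)" using nk p by simp
  also have "\<dots> = 1"
  proof -
    have "\<not> p dvd 2" using p(4) by (auto dest: dvd_imp_le)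
    then show ?thesis using p
      by (subst prime_elem_multiplicity_mult_distrib) (auto simp: not_dvd_imp_multiplicity_0)
  qed
  finally show False using two by simp
qed

context rigid_degree
begin

text \<open>Three kinds of primes: up to s each prime power is at most n; between s and k exponents
  are at most 1, so the primorial of b bounds the product; above k exponents are again at most 1 and
  the primes divide (n-r)(n-k+r), which accounts for the 2 in the exponent.\<close>

lemma choose_le:
  assumes n2: "n < (k + 1)\<^sup>2" and s: "n < (s + 1)\<^sup>2"
    and b: "\<And>p. prime p \<Longrightarrow> p dvd n choose k \<Longrightarrow> p \<le> k \<Longrightarrow> p \<le> b"
  shows "n choose k \<le> n ^ (prime_count s + 2) * 4 ^ b"
proof -
  let ?C = "n choose k"
  let ?q = "\<lambda>p. p ^ multiplicity p ?C"
  define A where "A = {p \<in> prime_factors ?C. p \<le> s}"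
  define B where "B = {p \<in> prime_factors ?C. s < p \<and> p \<le> k}"
  define D where "D = {p \<in> prime_factors ?C. s < p \<and> k < p}"
  have C0: "?C \<noteq> 0" using nk by simp
  have n0: "0 < n" using nk k4 by simp
  have fin: "finite A" "finite B" "finite D" by (auto simp: A_def B_def D_def)
  have qle: "?q p \<le> n" if "prime p" for p
    using that nk k4 by (intro prime_power_choose_le) auto
  have q1: "?q p \<le> p" if "prime p" "s < p" for p
  proof -
    have "multiplicity p ?C < 2"
    proof (rule ccontr)
      assume "\<not> ?thesis"
      then have "p ^ 2 \<le> ?q p" using that by (intro power_increasing) (auto simp: prime_ge_1_nat)
      moreover have "(s + 1)\<^sup>2 \<le> p ^ 2" using that by (intro power_mono) auto
      ultimately show False using s qle[OF that(1)] by linarith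
    qed
    then have "?q p \<le> p ^ 1" using that by (intro power_increasing) (auto simp: prime_ge_1_nat)
    then show ?thesis by simp
  qed
  have "?C = (\<Prod>p\<in>prime_factors ?C. ?q p)" using C0 by (intro prime_factorization_nat) simp
  also have "prime_factors ?C = A \<union> (B \<union> D)" by (auto simp: A_def B_def D_def)
  also have "(\<Prod>p\<in>\<dots>. ?q p) = (\<Prod>p\<in>A. ?q p) * ((\<Prod>p\<in>B. ?q p) * (\<Prod>p\<in>D. ?q p))"
    using fin by (subst prod.union_disjoint, auto simp: A_def B_def D_def)
      (subst prod.union_disjoint, auto)
  finally have C: "?C = (\<Prod>p\<in>A. ?q p) * ((\<Prod>p\<in>B. ?q p) * (\<Prod>p\<in>D. ?q p))" .
  have "(\<Prod>p\<in>A. ?q p) \<le> (\<Prod>p\<in>A. n)"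
    using qle by (intro prod_mono) (auto simp: A_def in_prime_factors_iff)
  also have "\<dots> = n ^ card A" by simp
  also have "\<dots> \<le> n ^ prime_count s"
  proof (intro power_increasing)
    show "card A \<le> prime_count s" unfolding prime_count_def A_def by (intro card_mono) auto
  qed (use n0 in simp)
  finally have A: "(\<Prod>p\<in>A. ?q p) \<le> n ^ prime_count s" .
  have "(\<Prod>p\<in>B. ?q p) \<le> \<Prod>B"
    using q1 by (intro prod_mono) (auto simp: B_def in_prime_factors_iff)
  also have "\<Prod>B \<le> primorial b"
    unfolding primorial_def
  proof (intro dvd_imp_le prod_dvd_prod_subset)
    show "B \<subseteq> {p. prime p \<and> p \<le> b}" using b by (auto simp: B_def in_prime_factors_iff)
  qed (auto intro!: prod_pos simp: prime_gt_0_nat)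
  also have "\<dots> \<le> 4 ^ b" by (rule primorial_le)
  finally have B: "(\<Prod>p\<in>B. ?q p) \<le> 4 ^ b" .
  have "(\<Prod>p\<in>D. ?q p) \<le> \<Prod>D"
    using q1 by (intro prod_mono) (auto simp: D_def in_prime_factors_iff)
  also have "\<dots> \<le> (n - r) * (n - (k - r))"
  proof (intro dvd_imp_le prod_primes_dvd fin)
    fix p assume "p \<in> D"
    then have p: "prime p" "p dvd ?C" "k < p" by (auto simp: D_def in_prime_factors_iff)
    then have "p dvd (\<Prod>i<k. n - i)" using nk by (simp flip: choose_mult_fact)
    then obtain l where l: "l < k" "p dvd n - l" using p by (auto simp: prime_dvd_prod_iff)
    then have "l = r \<or> l = k - r" using below_square[OF n2 _ p(1,3) l(2)] by simp
    then show "prime p \<and> p dvd (n - r) * (n - (k - r))" using l p by auto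
  qed (use nk k4 r2 in auto)
  also have "\<dots> \<le> n * n" by (intro mult_mono) auto
  finally have D: "(\<Prod>p\<in>D. ?q p) \<le> n * n" .
  have "(\<Prod>p\<in>A. ?q p) * ((\<Prod>p\<in>B. ?q p) * (\<Prod>p\<in>D. ?q p)) \<le>
      n ^ prime_count s * (4 ^ b * (n * n))"
    by (intro mult_mono A B D) auto
  with C have "?C \<le> n ^ prime_count s * (4 ^ b * (n * n))" by (rule ord_eq_le_trans)
  then show ?thesis by (simp add: power_add power2_eq_square mult_ac)
qed

end

text \<open>Factor by factor, n - i is at least n/(2k) times 2k - i, which reduces the estimate to
  the central binomial coefficient and its lower bound 4^k / (2k).\<close>

lemma choose_ge:
  assumes "0 < k" "2 * k \<le> n"
  shows "(2 * real n / real k) ^ k / (2 * real k) \<le> real (n choose k)"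
proof -
  define P where "P = (\<lambda>m. \<Prod>i<k. real (m - i))"
  have P: "real (m choose k) * fact k = P m" if "k \<le> m" for m
    using arg_cong[OF choose_mult_fact[OF that], of real] by (simp add: P_def)
  have "(real n / (2 * k)) ^ k * P (2 * k) = (\<Prod>i<k. real n / (2 * k) * real (2 * k - i))"
    by (simp only: P_def prod.distrib prod_constant card_lessThan)
  also have "\<dots> \<le> P n"
    unfolding P_def
  proof (intro prod_mono conjI)
    fix i assume i: "i \<in> {..<k}"
    then have e: "real (2 * k - i) = 2 * real k - real i" "real (n - i) = real n - real i"
      using assms by (simp_all add: of_nat_diff)
    have "real i * n \<ge> real i * (2 * k)" using assms by (intro mult_left_mono) linarith+
    then show "real n / (2 * k) * real (2 * k - i) \<le> real (n - i)"
      unfolding e using assms by (simp add: field_simps)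
  qed auto
  finally have "(real n / (2 * k)) ^ k * (real ((2 * k) choose k) * fact k) \<le> real (n choose k) * fact k"
    using P assms by simp
  then have le: "(real n / (2 * k)) ^ k * real ((2 * k) choose k) \<le> real (n choose k)"
    by (simp add: mult.assoc[symmetric])
  have "(2 * real n / real k) ^ k / (2 * real k) = (real n / (2 * k)) ^ k * (4 ^ k / (2 * real k))"
    using assms by (simp add: power_divide power_mult_distrib field_simps) (simp add: power_mult_distrib[symmetric])
  also have "\<dots> \<le> (real n / (2 * k)) ^ k * real ((2 * k) choose k)"
    using central_binomial_lower_bound[OF assms(1)] by (intro mult_left_mono) auto
  finally show ?thesis using le by simp
qed

section \<open>The range below the square\<close>

text \<open>The tangent of ln at 2^m, with ln 2 <= 25/36. It is accurate when 2^m is close to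
  x.\<close>

lemma ln_le_tangent:
  fixes x :: real
  assumes "0 < x"
  shows "ln x \<le> x / 2 ^ m + m * (25 / 36) - 1"
proof -
  have "ln (x / 2 ^ m) \<le> x / 2 ^ m - 1" using assms by (intro ln_le_minus_one) simp
  moreover have "ln (x / 2 ^ m) = ln x - m * ln 2" using assms by (simp add: ln_div ln_realpow)
  moreover have "real m * ln 2 \<le> m * (25 / 36)" using ln2_le_25_over_36 by (intro mult_left_mono) auto
  ultimately show ?thesis by linarith
qed

text \<open>From 2^19 < 3^12 and ln 2 >= 2/3.\<close>

lemma ln_3_ge: "19 / 18 \<le> ln (3 :: real)"
proof -
  have "19 * ln 2 = ln ((2::real) ^ 19)" by (subst ln_realpow) auto
  also have "\<dots> \<le> ln ((3::real) ^ 12)" by (subst ln_le_cancel_iff) auto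
  also have "\<dots> = 12 * ln 3" by (subst ln_realpow) auto
  finally show ?thesis using ln2_ge_two_thirds by linarith
qed

lemma ln_ge_one_minus_inverse:
  fixes x :: real
  assumes "0 < x"
  shows "1 - 1 / x \<le> ln x"
  using ln_le_minus_one[of "1 / x"] assms by (simp add: ln_div)

context rigid_degree
begin

lemma log_choose_bound:
  fixes b :: nat
  assumes n2: "n < (k + 1)\<^sup>2" and b: "\<And>p. prime p \<Longrightarrow> p dvd n choose k \<Longrightarrow> p \<le> k \<Longrightarrow> p \<le> b"
  shows "k * ln (2 * real n / real k) \<le> (sqrt n / 2 + 25 / 2) * ln (sqrt n) + 2 * b * ln 2"
proof -
  define s where "s = nat \<lfloor>sqrt n\<rfloor>"
  have s: "real s \<le> sqrt n" "sqrt n < real s + 1"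
    unfolding s_def by (simp_all add: of_nat_nat)
  have "(sqrt n)\<^sup>2 < (real s + 1)\<^sup>2" using s by (intro power_strict_mono) auto
  then have "real n < real ((s + 1)\<^sup>2)" by (simp add: add.commute)
  then have "n < (s + 1)\<^sup>2" by (simp only: of_nat_less_iff)
  then have "n choose k \<le> n ^ (prime_count s + 2) * 4 ^ b" using n2 b by (intro choose_le)
  then have "real (n choose k) \<le> real (n ^ (prime_count s + 2) * 4 ^ b)" by (simp only: of_nat_le_iff)
  moreover have "(2 * real n / real k) ^ k / (2 * real k) \<le> real (n choose k)" using k4 nk by (intro choose_ge) auto
  ultimately have "(2 * real n / real k) ^ k / (2 * real k) \<le> real n ^ (prime_count s + 2) * 4 ^ b" by simp
  then have "ln ((2 * real n / real k) ^ k / (2 * real k)) \<le> ln (real n ^ (prime_count s + 2) * 4 ^ b)"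
    using k4 nk by (subst ln_le_cancel_iff) auto
  moreover have "ln ((2 * real n / real k) ^ k / (2 * real k)) = k * ln (2 * real n / real k) - ln (2 * k)"
    using k4 nk by (simp add: ln_div ln_realpow)
  moreover have "ln (real n ^ (prime_count s + 2) * 4 ^ b) = (prime_count s + 2) * ln n + b * ln 4"
  proof -
    have "ln (real n ^ m) = m * ln n" for m by (rule ln_realpow)
    moreover have "ln ((4::real) ^ b) = b * ln 4" by (rule ln_realpow)
    moreover have "ln (real n ^ (prime_count s + 2) * 4 ^ b) = ln (real n ^ (prime_count s + 2)) + ln (4 ^ b)"
      using k4 nk by (subst ln_mult) auto
    ultimately show ?thesis by (simp only:)
  qed
  moreover have "ln (2 * real k) \<le> ln n" using k4 nk by (subst ln_le_cancel_iff) auto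
  \<comment> \<open>The third extra ln n pays for the denominator 2k of the lower bound; 25/4 is
    13/4 + 3.\<close>
  moreover have "(real (prime_count s) + 3) * ln n \<le> (sqrt n / 4 + 25 / 4) * ln n"
  proof (intro mult_right_mono)
    show "real (prime_count s) + 3 \<le> sqrt n / 4 + 25 / 4" using prime_count_le[of s] s by linarith
  qed (use k4 nk in auto)
  moreover have "ln (real n) = 2 * ln (sqrt n)" using k4 nk by (simp add: ln_sqrt)
  moreover have "ln (4::real) = 2 * ln 2" using ln_realpow[of 2 2] by simp
  ultimately show ?thesis by (simp add: algebra_simps)
qed

text \<open>With b = k the factors 4^k of both bounds cancel, and the contradiction must come from k
  ln (n/(2k)). This gain vanishes as n approaches 2k, so for n < 3k the primes in (n/3, k] are
  removed by taking b = n div 3.\<close>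

lemma large_case_false:
  assumes n2: "n < (k + 1)\<^sup>2" and large: "600 \<le> k"
  shows False
proof -
  define t where "t = sqrt n"
  have t2: "t * t = n" by (simp add: t_def)
  have k0: "real k \<ge> 600" "real n \<ge> 2 * k" using large nk by linarith+
  \<comment> \<open>34^2 = 1156 <= 2 * 600, and below 60^2 = 6 * 600.\<close>
  have t34: "t \<ge> 34"
  proof -
    have "sqrt (34\<^sup>2) \<le> sqrt n" using k0 by (intro real_sqrt_le_mono) simp
    then show ?thesis by (simp add: t_def)
  qed
  have t60: "t \<ge> 60" if "n \<ge> 6 * k"
  proof -
    have "sqrt (60\<^sup>2) \<le> sqrt n" using that k0 by (intro real_sqrt_le_mono) simp
    then show ?thesis by (simp add: t_def)
  qed
  have "ln t \<le> t / 2 ^ 5 + (5::nat) * (25 / 36) - 1" using t34 by (intro ln_le_tangent) simp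
  then have lnt: "ln t \<le> t / 32 + 89 / 36" by simp
  have "(t / 2 + 25 / 2) * ln t \<le> (t / 2 + 25 / 2) * (t / 32 + 89 / 36)"
    using lnt t34 by (intro mult_left_mono) auto
  also have "\<dots> = real n / 64 + (25 / 64 + 89 / 72) * t + 2225 / 72"
    by (simp add: field_simps flip: t2)
  also have "\<dots> \<le> real n / 64 + 1.63 * t + 31" using t34 by simp
  finally have E: "(t / 2 + 25 / 2) * ln t \<le> real n / 64 + 1.63 * t + 31" .
  consider "n < 3 * k" | "3 * k \<le> n" "n < 6 * k" | "6 * k \<le> n" by linarith
  then show False
  proof cases
    case 1
    have "p \<le> n div 3" if "prime p" "p dvd n choose k" "p \<le> k" for p
    proof (rule ccontr)
      assume "\<not> p \<le> n div 3"
      then have "n < 3 * p" by linarith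
      moreover from this have "2 < p" using nk large by linarith
      ultimately show False using prime_not_dvd_choose[OF nk that(1,3)] that(2) by blast
    qed
    then have "k * ln (2 * real n / real k) \<le> (t / 2 + 25 / 2) * ln t + 2 * (n div 3) * ln 2"
      unfolding t_def by (rule log_choose_bound[OF n2])
    moreover have "2 * real (n div 3) * ln 2 \<le> 2 * (n / 3) * ln 2"
    proof (intro mult_right_mono mult_left_mono)
      have "real (3 * (n div 3)) \<le> real n" by (subst of_nat_le_iff) simp
      then show "real (n div 3) \<le> n / 3" by simp
    qed auto
    moreover have "k * (2 * ln 2 + (1 - 2 * k / n)) \<le> k * ln (2 * real n / real k)"
    proof (intro mult_left_mono)
      have "1 - 1 / (n / (2 * k)) \<le> ln (n / (2 * k))" using k0 by (intro ln_ge_one_minus_inverse) auto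
      moreover have "ln (2 * real n / real k) = ln (4 * (n / (2 * k)))" using k0 by simp
      moreover have "\<dots> = ln 4 + ln (n / (2 * k))" using k0 by (subst ln_mult) auto
      moreover have "ln (4::real) = 2 * ln 2" using ln_realpow[of 2 2] by simp
      ultimately show "2 * ln 2 + (1 - 2 * k / n) \<le> ln (2 * real n / real k)" by simp
    qed simp
    ultimately have 1: "k * (2 * ln 2 + (1 - 2 * k / n)) - 2 * (n / 3) * ln 2 \<le> (t / 2 + 25 / 2) * ln t"
      by linarith
    have "(3 * real k - n) * (2 / 3) \<le> (3 * real k - n) * ln 2"
      using \<open>n < 3 * k\<close> ln2_ge_two_thirds by (intro mult_left_mono) auto
    then have 2: "4 / 9 * (3 * real k - n) \<le> 2 * k * ln 2 - 2 * (n / 3) * ln 2" by (simp add: field_simps)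
    \<comment> \<open>Multiplied by 9n/2, the next inequality is exactly the nonnegativity of this
      product.\<close>
    have "(2 * real n - 3 * real k) * (3 * real k - real n) \<ge> 0" using \<open>n < 3 * k\<close> k0 by (intro mult_nonneg_nonneg) linarith+
    then have "4 / 9 * (3 * real k - n) + k - 2 * real k * k / n \<ge> k / 3"
      using k0 by (simp add: field_simps)
    then have "k / 3 \<le> (t / 2 + 25 / 2) * ln t" using 1 2 by (simp add: algebra_simps)
    then have "k / 3 \<le> real n / 64 + 1.63 * t + 31" using E by linarith
    moreover have "real n < 3 * k" using \<open>n < 3 * k\<close> by linarith
    ultimately have "real n * (1 / 9 - 1 / 64) \<le> 1.63 * t + 31" by simp
    moreover have "real n \<ge> 34 * t" using t34 by (simp flip: t2)
    ultimately show False using t34 by simp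
  next
    case 2
    have "k * ln (2 * real n / real k) \<le> (t / 2 + 25 / 2) * ln t + 2 * k * ln 2"
      unfolding t_def by (rule log_choose_bound[OF n2])
    moreover have "k * (2 * ln 2 + 1 / 3) \<le> k * ln (2 * real n / real k)"
    proof (intro mult_left_mono)
      have "1 - 1 / (n / (2 * k)) \<le> ln (n / (2 * k))" using k0 by (intro ln_ge_one_minus_inverse) auto
      moreover have "1 / (n / (2 * k)) \<le> 2 / 3" using 2 k0 by (simp add: field_simps)
      moreover have "ln (2 * real n / real k) = ln (4 * (n / (2 * k)))" using k0 by simp
      moreover have "\<dots> = ln 4 + ln (n / (2 * k))" using k0 by (subst ln_mult) auto
      moreover have "ln (4::real) = 2 * ln 2" using ln_realpow[of 2 2] by simp
      ultimately show "2 * ln 2 + 1 / 3 \<le> ln (2 * real n / real k)" by simp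
    qed simp
    ultimately have "k / 3 \<le> (t / 2 + 25 / 2) * ln t" by (simp add: algebra_simps)
    then have *: "k / 3 \<le> real n / 64 + 1.63 * t + 31" using E by linarith
    have n6: "real n < 6 * k" using 2 by linarith
    show False
    proof (cases "t \<le> 60")
      case True
      then have "t * t \<le> 60 * 60" using t34 by (intro mult_mono) auto
      then show False using * k0 True by (simp add: t2)
    next
      case False
      then have "real n \<ge> 60 * t" by (simp flip: t2)
      then show False using * n6 False by simp
    qed
  next
    case 3
    have t60: "t \<ge> 60" using t60 3 by simp
    define L where "L = ln (n / (2 * k))"
    have "k * ln (2 * real n / real k) \<le> (t / 2 + 25 / 2) * ln t + 2 * k * ln 2"
      unfolding t_def by (rule log_choose_bound[OF n2])
    moreover have "ln (2 * real n / real k) = ln (4 * (n / (2 * k)))" using k0 by simp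
    moreover have "\<dots> = ln 4 + L" unfolding L_def using k0 by (subst ln_mult) auto
    moreover have "ln (4::real) = 2 * ln 2" using ln_realpow[of 2 2] by simp
    ultimately have kL: "k * L \<le> (t / 2 + 25 / 2) * ln t" by (simp add: algebra_simps)
    have "real n < (real k + 1)\<^sup>2" using n2 by (metis of_nat_1 of_nat_add of_nat_less_iff of_nat_power)
    then have "t < real k + 1" unfolding t_def by (intro real_less_lsqrt) auto
    then have tk: "t - 1 \<le> k" by simp
    have "ln 3 \<le> L" unfolding L_def using 3 k0 by (subst ln_le_cancel_iff) (auto simp: field_simps)
    then have L1: "1 \<le> L" using ln_3_ge by linarith
    \<comment> \<open>For fixed n the function x ln (n/(2x)) increases while n/(2x) >= e, which
      \<open>L1\<close> ensures. Its value at k is therefore at least that at t - 1, the least k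
      allowed by n < (k+1)^2 up to rounding.\<close>
    have "ln (k / (t - 1)) \<le> k / (t - 1) - 1" using t60 k0 by (intro ln_le_minus_one) auto
    then have "(t - 1) * ln (k / (t - 1)) \<le> (t - 1) * (k / (t - 1) - 1)" using t60 by (intro mult_left_mono) auto
    also have "\<dots> = k - (t - 1)" using t60 by (simp add: field_simps)
    also have "\<dots> \<le> (k - (t - 1)) * L" using L1 tk mult_left_mono[of 1 L "k - (t - 1)"] by simp
    finally have "(t - 1) * (ln (k / (t - 1)) + L) \<le> k * L" by (simp add: algebra_simps)
    moreover have "ln t - ln 2 \<le> ln (k / (t - 1)) + L"
    proof -
      have "ln (k / (t - 1)) + L = ln (k / (t - 1) * (n / (2 * k)))"
        unfolding L_def using t60 k0 by (subst ln_mult) auto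
      also have "k / (t - 1) * (n / (2 * k)) = t * t / (2 * (t - 1))" using k0 by (simp add: t2)
      finally have "ln (k / (t - 1)) + L = ln (t * t / (2 * (t - 1)))" .
      moreover have "ln t - ln 2 = ln (t / 2)" using t60 by (simp add: ln_div)
      moreover have "t / 2 \<le> t * t / (2 * (t - 1))" using t60 by (simp add: field_simps)
      ultimately show ?thesis using t60 by simp
    qed
    then have "(t - 1) * (ln t - ln 2) \<le> (t - 1) * (ln (k / (t - 1)) + L)"
      using t60 by (intro mult_left_mono) auto
    ultimately have "(t - 1) * (ln t - ln 2) \<le> (t / 2 + 25 / 2) * ln t" using kL by linarith
    then have "(t / 2 - 27 / 2) * ln t \<le> (t - 1) * ln 2" by (simp add: algebra_simps)
    also have "\<dots> \<le> (t - 1) * (25 / 36)" using t60 ln2_le_25_over_36 by (intro mult_left_mono) auto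
    finally have "(t / 2 - 27 / 2) * ln t \<le> (t - 1) * (25 / 36)" .
    moreover have "10 / 3 \<le> ln t"
    proof -
      have "5 * ln 2 = ln ((2::real) ^ 5)" by (subst ln_realpow) auto
      also have "\<dots> \<le> ln t" using t60 by (subst ln_le_cancel_iff) auto
      finally show ?thesis using ln2_ge_two_thirds by linarith
    qed
    then have "(t / 2 - 27 / 2) * (10 / 3) \<le> (t / 2 - 27 / 2) * ln t"
      using t60 by (intro mult_left_mono) auto
    ultimately show False using t60 by simp
  qed
qed

text \<open>Three primes above k in [n-k, n] sit at three distinct indices l, while only r and k - r
  are allowed.\<close>

lemma three_primes_false:
  assumes n2: "n < (k + 1)\<^sup>2" and "n - k \<le> p1" "k < p1" "p1 < p2" "p2 < p3" "p3 \<le> n"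
    and "prime p1" "prime p2" "prime p3"
  shows False
proof -
  have "n - p = r \<or> n - p = k - r" if "prime p" "p1 \<le> p" "p \<le> n" for p
    using that assms by (intro below_square[OF n2, of _ p]) auto
  from this[of p1] this[of p2] this[of p3] show False using assms by auto
qed

end

section \<open>Three primes between 3n/4 and n\<close>

definition prime_test :: "int \<Rightarrow> bool" where
  "prime_test p \<longleftrightarrow> 1 < p \<and> p < 49729 \<and> list_all (\<lambda>d. p < d * d \<or> p mod d \<noteq> 0) small_primes"

text \<open>The bound \<open>49729 = 223\<^sup>2\<close> is the square of the first prime missing from \<^const>\<open>small_primes\<close>.\<close>

lemma prime_by_test:
  assumes "prime_test (int p)"
  shows "prime p"
proof (rule ccontr)
  assume np: "\<not> prime p"
  have p: "1 < p" "int p < 49729"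
    and nd: "\<forall>d\<in>set small_primes. int p < d * d \<or> int p mod d \<noteq> 0"
    using assms by (auto simp: prime_test_def list_all_iff)
  obtain a where a: "a dvd p" "a \<noteq> 1" "a \<noteq> p" using np p(1) by (auto simp: prime_nat_iff)
  then obtain b where b: "p = a * b" by auto
  have "a \<noteq> 0" using b p(1) by (intro notI) simp
  moreover have "b \<noteq> 0" "b \<noteq> 1" using a b p(1) by (intro notI; simp)+
  ultimately have ab: "1 < a" "1 < b" using a(2) by linarith+
  define m where "m = min a b"
  have m: "1 < m" "m * m \<le> p" "m dvd p"
    using ab b by (auto simp: m_def min_def intro: mult_mono)
  obtain q where q: "prime q" "q dvd m" using m prime_factor_nat[of m] by auto
  have "q \<le> m" using q m by (intro dvd_imp_le) auto
  then have qq: "q * q \<le> p" using m(2) mult_le_mono[of q m q m] by linarith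
  have "q \<le> 222"
  proof (rule ccontr)
    assume "\<not> q \<le> 222"
    then have "223 * 223 \<le> q * q" by (intro mult_le_mono) auto
    then show False using qq p(2) by simp
  qed
  then have "int q \<in> set small_primes" using q by (intro prime_in_small_primes)
  then have "int p < int q * int q \<or> int p mod int q \<noteq> 0" by (rule bspec[OF nd])
  moreover have "int q * int q \<le> int p" using qq by (simp flip: of_nat_mult)
  moreover have "q dvd p" using q m by (blast intro: dvd_trans)
  then have "int p mod int q = 0" by (simp flip: of_nat_mod)
  ultimately show False by simp
qed

text \<open>The stock of primes from which the triples of \<open>three_primes\<close> are taken,
  certified in one evaluation.\<close>

lemma chain_primes:
  shows "prime (47::nat)"
    and "prime (53::nat)"
    and "prime (59::nat)"
    and "prime (61::nat)"
    and "prime (67::nat)"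
    and "prime (71::nat)"
    and "prime (73::nat)"
    and "prime (79::nat)"
    and "prime (83::nat)"
    and "prime (89::nat)"
    and "prime (97::nat)"
    and "prime (101::nat)"
    and "prime (103::nat)"
    and "prime (109::nat)"
    and "prime (113::nat)"
    and "prime (127::nat)"
    and "prime (131::nat)"
    and "prime (137::nat)"
    and "prime (139::nat)"
    and "prime (163::nat)"
    and "prime (167::nat)"
    and "prime (173::nat)"
    and "prime (197::nat)"
    and "prime (199::nat)"
    and "prime (211::nat)"
    and "prime (251::nat)"
    and "prime (257::nat)"
    and "prime (263::nat)"
    and "prime (313::nat)"
    and "prime (317::nat)"
    and "prime (331::nat)"
    and "prime (397::nat)"
    and "prime (401::nat)"
    and "prime (409::nat)"
    and "prime (509::nat)"
    and "prime (521::nat)"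
    and "prime (523::nat)"
    and "prime (661::nat)"
    and "prime (673::nat)"
    and "prime (677::nat)"
    and "prime (863::nat)"
    and "prime (877::nat)"
    and "prime (881::nat)"
    and "prime (1123::nat)"
    and "prime (1129::nat)"
    and "prime (1151::nat)"
    and "prime (1487::nat)"
    and "prime (1489::nat)"
    and "prime (1493::nat)"
    and "prime (1951::nat)"
    and "prime (1973::nat)"
    and "prime (1979::nat)"
proof -
  have "list_all prime_test [47, 53, 59, 61, 67, 71, 73, 79, 83, 89, 97, 101, 103, 109, 113, 127, 131, 137, 139, 163, 167, 173, 197, 199, 211, 251, 257, 263, 313, 317, 331, 397, 401, 409, 509, 521, 523, 661, 673, 677, 863, 877, 881, 1123, 1129, 1151, 1487, 1489, 1493, 1951, 1973, 1979]" by code_simp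
  then have T: "prime_test 47 \<and> prime_test 53 \<and> prime_test 59 \<and> prime_test 61 \<and> prime_test 67 \<and> prime_test 71 \<and> prime_test 73 \<and> prime_test 79 \<and> prime_test 83 \<and> prime_test 89 \<and> prime_test 97 \<and> prime_test 101 \<and> prime_test 103 \<and> prime_test 109 \<and> prime_test 113 \<and> prime_test 127 \<and> prime_test 131 \<and> prime_test 137 \<and> prime_test 139 \<and> prime_test 163 \<and> prime_test 167 \<and> prime_test 173 \<and> prime_test 197 \<and> prime_test 199 \<and> prime_test 211 \<and> prime_test 251 \<and> prime_test 257 \<and> prime_test 263 \<and> prime_test 313 \<and> prime_test 317 \<and> prime_test 331 \<and> prime_test 397 \<and> prime_test 401 \<and> prime_test 409 \<and> prime_test 509 \<and> prime_test 521 \<and> prime_test 523 \<and> prime_test 661 \<and> prime_test 673 \<and> prime_test 677 \<and> prime_test 863 \<and> prime_test 877 \<and> prime_test 881 \<and> prime_test 1123 \<and> prime_test 1129 \<and> prime_test 1151 \<and> prime_test 1487 \<and> prime_test 1489 \<and> prime_test 1493 \<and> prime_test 1951 \<and> prime_test 1973 \<and> prime_test 1979"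
    by (simp only: list.pred_inject simp_thms)
  show "prime (47::nat)" "prime (53::nat)" "prime (59::nat)" "prime (61::nat)" "prime (67::nat)" "prime (71::nat)" "prime (73::nat)" "prime (79::nat)" "prime (83::nat)" "prime (89::nat)" "prime (97::nat)" "prime (101::nat)" "prime (103::nat)" "prime (109::nat)" "prime (113::nat)" "prime (127::nat)" "prime (131::nat)" "prime (137::nat)" "prime (139::nat)" "prime (163::nat)" "prime (167::nat)" "prime (173::nat)" "prime (197::nat)" "prime (199::nat)" "prime (211::nat)" "prime (251::nat)" "prime (257::nat)" "prime (263::nat)" "prime (313::nat)" "prime (317::nat)" "prime (331::nat)" "prime (397::nat)" "prime (401::nat)" "prime (409::nat)" "prime (509::nat)" "prime (521::nat)" "prime (523::nat)" "prime (661::nat)" "prime (673::nat)" "prime (677::nat)" "prime (863::nat)" "prime (877::nat)" "prime (881::nat)" "prime (1123::nat)" "prime (1129::nat)" "prime (1151::nat)" "prime (1487::nat)" "prime (1489::nat)" "prime (1493::nat)" "prime (1951::nat)" "prime (1973::nat)" "prime (1979::nat)"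
    by (rule prime_by_test, simp only: of_nat_numeral T)+
qed

text \<open>A triple serves all n from p3 to 4 p1 / 3, and eighteen further triples continue the
  first without a gap up to 2601, the integer part of 4 * 1951 / 3. At n = 58 the claim fails: only
  47 and 53 lie between 43.5 and 58. The ratio 3/4 fits n < 4k, which gives n - k < 3n/4, and 3n/4 >
  k.\<close>

lemma three_primes:
  assumes "59 \<le> n" "n \<le> 2601"
  shows "\<exists>p1 p2 p3. prime p1 \<and> prime p2 \<and> prime p3 \<and> p1 < p2 \<and> p2 < p3 \<and> p3 \<le> n \<and> 3 * n \<le> 4 * (p1::nat)"
proof -
  have *: ?thesis if "prime p1" "prime p2" "prime p3" "p1 < p2" "p2 < p3" "p3 \<le> n" "3 * n \<le> 4 * p1" for p1 p2 p3
    using that by blast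
  have c18: ?thesis if "1983 \<le> n"
    by (rule *[OF chain_primes(50) chain_primes(51) chain_primes(52)]; use that assms in simp)
  have c17: ?thesis if "1498 \<le> n"
  proof (cases "n \<le> 1982")
    case True
    show ?thesis by (rule *[OF chain_primes(47) chain_primes(48) chain_primes(49)]; use that True in simp)
  qed (use c18 in simp)
  have c16: ?thesis if "1151 \<le> n"
  proof (cases "n \<le> 1497")
    case True
    show ?thesis by (rule *[OF chain_primes(44) chain_primes(45) chain_primes(46)]; use that True in simp)
  qed (use c17 in simp)
  have c15: ?thesis if "882 \<le> n"
  proof (cases "n \<le> 1150")
    case True
    show ?thesis by (rule *[OF chain_primes(41) chain_primes(42) chain_primes(43)]; use that True in simp)
  qed (use c16 in simp)
  have c14: ?thesis if "679 \<le> n"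
  proof (cases "n \<le> 881")
    case True
    show ?thesis by (rule *[OF chain_primes(38) chain_primes(39) chain_primes(40)]; use that True in simp)
  qed (use c15 in simp)
  have c13: ?thesis if "530 \<le> n"
  proof (cases "n \<le> 678")
    case True
    show ?thesis by (rule *[OF chain_primes(35) chain_primes(36) chain_primes(37)]; use that True in simp)
  qed (use c14 in simp)
  have c12: ?thesis if "418 \<le> n"
  proof (cases "n \<le> 529")
    case True
    show ?thesis by (rule *[OF chain_primes(32) chain_primes(33) chain_primes(34)]; use that True in simp)
  qed (use c13 in simp)
  have c11: ?thesis if "335 \<le> n"
  proof (cases "n \<le> 417")
    case True
    show ?thesis by (rule *[OF chain_primes(29) chain_primes(30) chain_primes(31)]; use that True in simp)
  qed (use c12 in simp)
  have c10: ?thesis if "263 \<le> n"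
  proof (cases "n \<le> 334")
    case True
    show ?thesis by (rule *[OF chain_primes(26) chain_primes(27) chain_primes(28)]; use that True in simp)
  qed (use c11 in simp)
  have c9: ?thesis if "218 \<le> n"
  proof (cases "n \<le> 262")
    case True
    show ?thesis by (rule *[OF chain_primes(23) chain_primes(24) chain_primes(25)]; use that True in simp)
  qed (use c10 in simp)
  have c8: ?thesis if "175 \<le> n"
  proof (cases "n \<le> 217")
    case True
    show ?thesis by (rule *[OF chain_primes(20) chain_primes(21) chain_primes(22)]; use that True in simp)
  qed (use c9 in simp)
  have c7: ?thesis if "146 \<le> n"
  proof (cases "n \<le> 174")
    case True
    show ?thesis by (rule *[OF chain_primes(17) chain_primes(18) chain_primes(19)]; use that True in simp)
  qed (use c8 in simp)
  have c6: ?thesis if "130 \<le> n"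
  proof (cases "n \<le> 145")
    case True
    show ?thesis by (rule *[OF chain_primes(14) chain_primes(15) chain_primes(16)]; use that True in simp)
  qed (use c7 in simp)
  have c5: ?thesis if "106 \<le> n"
  proof (cases "n \<le> 129")
    case True
    show ?thesis by (rule *[OF chain_primes(11) chain_primes(12) chain_primes(13)]; use that True in simp)
  qed (use c6 in simp)
  have c4: ?thesis if "95 \<le> n"
  proof (cases "n \<le> 105")
    case True
    show ?thesis by (rule *[OF chain_primes(8) chain_primes(9) chain_primes(10)]; use that True in simp)
  qed (use c5 in simp)
  have c3: ?thesis if "82 \<le> n"
  proof (cases "n \<le> 94")
    case True
    show ?thesis by (rule *[OF chain_primes(6) chain_primes(7) chain_primes(8)]; use that True in simp)
  qed (use c4 in simp)
  have c2: ?thesis if "71 \<le> n"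
  proof (cases "n \<le> 81")
    case True
    show ?thesis by (rule *[OF chain_primes(4) chain_primes(5) chain_primes(6)]; use that True in simp)
  qed (use c3 in simp)
  have c1: ?thesis if "63 \<le> n"
  proof (cases "n \<le> 70")
    case True
    show ?thesis by (rule *[OF chain_primes(2) chain_primes(3) chain_primes(4)]; use that True in simp)
  qed (use c2 in simp)
  have c0: ?thesis if "59 \<le> n"
  proof (cases "n \<le> 62")
    case True
    show ?thesis by (rule *[OF chain_primes(1) chain_primes(2) chain_primes(3)]; use that True in simp)
  qed (use c1 in simp)
  show ?thesis using c0 assms by simp
qed

text \<open>Makes a deletion bound numerical: an upper bound c for the prime count and a y with
  y^(d-c) > m! suffice.\<close>

lemma power_prime_count_less:
  fixes x y :: nat
  assumes "x ^ (d - prime_count k) \<le> fact m" "prime_count k \<le> c" "fact m < y ^ (d - c)" "0 < y"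
  shows "x < y"
proof (rule ccontr)
  assume "\<not> x < y"
  then have "y ^ (d - c) \<le> x ^ (d - c)" by (intro power_mono) auto
  also have "\<dots> \<le> x ^ (d - prime_count k)" using assms \<open>\<not> x < y\<close> by (intro power_increasing) auto
  finally show False using assms by simp
qed

lemma prime_count_table:
  shows "prime_count 4 \<le> 2"
    and "prime_count 6 \<le> 3"
    and "prime_count 8 \<le> 4"
    and "prime_count 9 \<le> 4"
    and "prime_count 10 \<le> 4"
    and "prime_count 11 \<le> 5"
    and "prime_count 12 \<le> 5"
    and "prime_count 13 \<le> 6"
    and "prime_count 14 \<le> 6"
    and "prime_count 15 \<le> 6"
    and "prime_count 16 \<le> 6"
    and "prime_count 17 \<le> 7"
    and "prime_count 18 \<le> 7"
    and "prime_count 19 \<le> 8"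
    and "prime_count 20 \<le> 8"
    and "prime_count 21 \<le> 8"
    and "prime_count 22 \<le> 8"
    and "prime_count 23 \<le> 9"
    and "prime_count 24 \<le> 9"
    and "prime_count 26 \<le> 9"
    and "prime_count 28 \<le> 9"
    and "prime_count 30 \<le> 10"
    and "prime_count 32 \<le> 11"
    and "prime_count 34 \<le> 11"
    and "prime_count 36 \<le> 11"
    and "prime_count 38 \<le> 12"
    and "prime_count 40 \<le> 12"
    and "prime_count 42 \<le> 13"
    and "prime_count 44 \<le> 14"
    and "prime_count 46 \<le> 14"
  by (rule order_trans[OF prime_count_small]; simp add: small_primes_def)+

section \<open>Deletion bounds for n below the square\<close>

context rigid_degree
begin

text \<open>All n - l except those at r and k - r are k-smooth, so at least k - 1 smooth terms are
  available.\<close>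

lemma deletion_below_square:
  assumes n2: "n < (k + 1)\<^sup>2"
  shows "(n - k) ^ (k - 1 - prime_count k) \<le> fact k"
proof -
  let ?L = "{..k} - {r, k - r}"
  have "(n - k) ^ (card ?L - prime_count k) \<le> fact k"
  proof (rule smooth_run_bound)
    fix l assume l: "l \<in> ?L"
    show "smooth_nat k (n - l)"
      unfolding smooth_nat_def using below_square[OF n2, of l] l by (auto simp flip: not_less)
  qed (use nk k4 in auto)
  moreover have "k - 1 \<le> card ?L"
  proof -
    have "card {..k} - card {r, k - r} \<le> card ?L" by (intro diff_card_le_card_Diff) auto
    moreover have "card {r, k - r} \<le> 2" by (simp add: card_insert_if)
    ultimately show ?thesis by simp
  qed
  then have "(n - k) ^ (k - 1 - prime_count k) \<le> (n - k) ^ (card ?L - prime_count k)"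
    using nk k4 by (intro power_increasing) auto
  ultimately show ?thesis by linarith
qed

text \<open>For n >= 4k every term is at least 3k, and the exponent is about 3k/4. In logarithms the
  deletion bound then asks (k/4) ln k to exceed roughly 1.8 k, which does not happen for k <
  600.\<close>

lemma middle_case:
  assumes n2: "n < (k + 1)\<^sup>2" and n4: "4 * k \<le> n" and k: "24 \<le> k" "k < 600"
  shows False
proof -
  have "(3 * k) ^ (k - 1 - prime_count k) \<le> (n - k) ^ (k - 1 - prime_count k)"
    using n4 by (intro power_mono) auto
  also have "\<dots> \<le> fact k" by (rule deletion_below_square[OF n2])
  finally have "real ((3 * k) ^ (k - 1 - prime_count k)) \<le> real (fact k)" by (simp only: of_nat_le_iff)
  then have "ln (real ((3 * k) ^ (k - 1 - prime_count k))) \<le> ln (fact k)"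
    using k by (subst ln_le_cancel_iff) auto
  also have "\<dots> \<le> 1 + ln k + k * ln k - k" using k by (intro ln_fact_le) auto
  finally have "ln (real ((3 * k) ^ (k - 1 - prime_count k))) \<le> 1 + ln k + k * ln k - k" .
  moreover have "ln (real ((3 * k) ^ (k - 1 - prime_count k))) = real (k - 1 - prime_count k) * ln (3 * k)"
    using k by (subst of_nat_power, subst ln_realpow) auto
  \<comment> \<open>The exponent comes from k - 1 - (k + 13)/4.\<close>
  moreover have "(3 / 4 * k - 17 / 4) * (19 / 18 + ln k) \<le> real (k - 1 - prime_count k) * ln (3 * k)"
  proof (intro mult_mono)
    show "3 / 4 * k - 17 / 4 \<le> real (k - 1 - prime_count k)" using prime_count_le[of k] by linarith
    show "19 / 18 + ln k \<le> ln (3 * k)" using k ln_3_ge by (simp add: ln_mult)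
    show "0 \<le> 19 / 18 + ln k" using k by (intro add_nonneg_nonneg) auto
  qed auto
  ultimately have *: "(3 / 4 * k - 17 / 4) * (19 / 18) + k - 1 \<le> (k / 4 + 21 / 4) * ln k"
    by (simp add: algebra_simps)
  \<comment> \<open>One tangent is too coarse for the whole range: ln is bounded at 32 up to k = 100
    and at 512 beyond. Each choice leaves a quadratic inequality in k, refuted by the product of
    distances to the ends of the interval.\<close>
  show False
  proof (cases "k \<le> 100")
    case True
    have "ln k \<le> k / 2 ^ 5 + (5::nat) * (25 / 36) - 1" using k by (intro ln_le_tangent) simp
    then have "(k / 4 + 21 / 4) * ln k \<le> (k / 4 + 21 / 4) * (k / 32 + 89 / 36)"
      by (intro mult_left_mono) auto
    moreover have "(real k - 24) * (100 - real k) \<ge> 0" using k True by (intro mult_nonneg_nonneg) auto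
    ultimately show False using * k by (simp add: field_simps)
  next
    case False
    have "ln k \<le> k / 2 ^ 9 + (9::nat) * (25 / 36) - 1" using k by (intro ln_le_tangent) simp
    then have "(k / 4 + 21 / 4) * ln k \<le> (k / 4 + 21 / 4) * (k / 512 + 21 / 4)"
      by (intro mult_left_mono) auto
    moreover have "(real k - 100) * (600 - real k) \<ge> 0" using k False by (intro mult_nonneg_nonneg) auto
    ultimately show False using * k False by (simp add: field_simps)
  qed
qed

text \<open>Three primes settle n < 4k from n = 59 on, with k < 600 keeping n inside the table;
  deletion settles n >= 4k. The latter starts at 14 because (3k)^(k-1-c) > k!, with c the number of
  primes up to k, still fails at k = 13.\<close>

lemma below_square_small:
  assumes n2: "n < (k + 1)\<^sup>2"
  shows "k < 14 \<or> n \<le> 58"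
proof (rule ccontr)
  assume "\<not> ?thesis"
  then have k: "14 \<le> k" "59 \<le> n" by auto
  have k6: "k < 600" using large_case_false[OF n2] not_less by blast
  show False
  proof (cases "n < 4 * k")
    case True
    then obtain p1 p2 p3 where p: "prime p1" "prime p2" "prime p3" "p1 < p2" "p2 < p3" "p3 \<le> n" "3 * n \<le> 4 * p1"
      using three_primes[of n] k k6 by auto
    show False by (rule three_primes_false[OF n2 _ _ p(4,5,6,1,2,3)]) (use p True nk in linarith)+
  next
    case False
    then have "3 * k \<le> n - k" by linarith
    then have le: "(3 * k) ^ (k - 1 - prime_count k) \<le> fact k"
      using deletion_below_square[OF n2] power_mono[of "3 * k" "n - k" "k - 1 - prime_count k"] by linarith
    have "k < 24" using middle_case[OF n2] False k6 not_less by blast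
    then have "k = 14 \<or> k = 15 \<or> k = 16 \<or> k = 17 \<or> k = 18 \<or> k = 19 \<or> k = 20 \<or> k = 21 \<or> k = 22 \<or> k = 23" using k by presburger
    then consider "k = 14" | "k = 15" | "k = 16" | "k = 17" | "k = 18" | "k = 19" | "k = 20" | "k = 21" | "k = 22" | "k = 23" by blast
    then show False
    proof cases
      case 1
      show False using power_prime_count_less[where y = "3 * 14", OF le[unfolded 1] prime_count_table(9)]
        by (simp add: fact_numeral)
    next
      case 2
      show False using power_prime_count_less[where y = "3 * 15", OF le[unfolded 2] prime_count_table(10)]
        by (simp add: fact_numeral)
    next
      case 3
      show False using power_prime_count_less[where y = "3 * 16", OF le[unfolded 3] prime_count_table(11)]
        by (simp add: fact_numeral)
    next
      case 4
      show False using power_prime_count_less[where y = "3 * 17", OF le[unfolded 4] prime_count_table(12)]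
        by (simp add: fact_numeral)
    next
      case 5
      show False using power_prime_count_less[where y = "3 * 18", OF le[unfolded 5] prime_count_table(13)]
        by (simp add: fact_numeral)
    next
      case 6
      show False using power_prime_count_less[where y = "3 * 19", OF le[unfolded 6] prime_count_table(14)]
        by (simp add: fact_numeral)
    next
      case 7
      show False using power_prime_count_less[where y = "3 * 20", OF le[unfolded 7] prime_count_table(15)]
        by (simp add: fact_numeral)
    next
      case 8
      show False using power_prime_count_less[where y = "3 * 21", OF le[unfolded 8] prime_count_table(16)]
        by (simp add: fact_numeral)
    next
      case 9
      show False using power_prime_count_less[where y = "3 * 22", OF le[unfolded 9] prime_count_table(17)]
        by (simp add: fact_numeral)
    next
      case 10
      show False using power_prime_count_less[where y = "3 * 23", OF le[unfolded 10] prime_count_table(18)]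
        by (simp add: fact_numeral)
    qed
  qed
qed

end

section \<open>The range above the square\<close>

context rigid_degree
begin

text \<open>For r different from k/2 at most four of the k + 1 terms escape smoothness, in all cases
  of divisibility by p or p^2.\<close>

lemma generic_bound:
  assumes "2 * r \<noteq> k"
  shows "(n - k) ^ (k - 3 - prime_count k) \<le> fact k"
proof -
  let ?E = "{r, k - r, 2 * r, k - 2 * r}"
  let ?L = "{..k} - ?E"
  have "(n - k) ^ (card ?L - prime_count k) \<le> fact k"
  proof (rule smooth_run_bound)
    fix l assume l: "l \<in> ?L"
    show "smooth_nat k (n - l)"
      unfolding smooth_nat_def
    proof (intro allI impI)
      fix p assume p: "prime p" "p dvd n - l"
      show "p \<le> k"
      proof (rule ccontr)
        assume "\<not> p \<le> k"
        then show False
          using simple_prime[of l p] square_prime[of l p] p l assms by (cases "p\<^sup>2 dvd n - l") auto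
      qed
    qed
  qed (use nk k4 in auto)
  moreover have "k - 3 \<le> card ?L"
  proof -
    have "card {..k} - card ?E \<le> card ?L" by (intro diff_card_le_card_Diff) auto
    moreover have "card ?E \<le> 4" by (simp add: card_insert_if)
    moreover have "card {..k} = k + 1" by simp
    ultimately show ?thesis by linarith
  qed
  then have "(n - k) ^ (k - 3 - prime_count k) \<le> (n - k) ^ (card ?L - prime_count k)"
    using nk k4 by (intro power_increasing) auto
  ultimately show ?thesis by linarith
qed

text \<open>From k = 25 on, 3k/4 - 25/4 >= k/2, so the exponent is at least k/2; as n - k > k^2, the
  power exceeds k^k.\<close>

lemma generic_less_25:
  assumes n: "(k + 1)\<^sup>2 \<le> n" and r: "2 * r \<noteq> k"
  shows "k < 25"
proof (rule ccontr)
  assume "\<not> k < 25"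
  then have k: "25 \<le> k" by simp
  let ?E = "k - 3 - prime_count k"
  have E: "k \<le> 2 * ?E" "?E > 0" using prime_count_le[of k] k by linarith+
  have "fact k \<le> k ^ k" using fact_le_power[of k, where 'a = nat] by simp
  also have "\<dots> \<le> k ^ (2 * ?E)" using E k by (intro power_increasing) auto
  also have "\<dots> = (k\<^sup>2) ^ ?E" by (simp add: power_mult)
  also have "\<dots> < (n - k) ^ ?E" using n E by (intro power_strict_mono) (auto simp: power2_eq_square)
  finally show False using generic_bound[OF r] by simp
qed

text \<open>Each constant y satisfies y^(k-3-c) > k! with c from \<open>prime_count_table\<close>.
  For k = 12 and k >= 14 the resulting bound for n contradicts n >= (k+1)^2, so these k
  disappear.\<close>

lemma generic_ranges:
  assumes n: "(k + 1)\<^sup>2 \<le> n" and r: "2 * r \<noteq> k"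
  shows "k \<le> 8 \<or> k = 9 \<and> n \<le> 611 \<or> k = 10 \<and> n \<le> 163 \<or> k = 11 \<and> n \<le> 352 \<or> k = 13 \<and> n \<le> 293"
proof (cases "k \<le> 8")
  case False
  note le = generic_bound[OF r]
  have "k = 9 \<or> k = 10 \<or> k = 11 \<or> k = 12 \<or> k = 13 \<or> k = 14 \<or> k = 15 \<or> k = 16 \<or> k = 17 \<or> k = 18 \<or> k = 19 \<or> k = 20 \<or> k = 21 \<or> k = 22 \<or> k = 23 \<or> k = 24" using generic_less_25[OF n r] False by presburger
  then consider "k = 9" | "k = 10" | "k = 11" | "k = 12" | "k = 13" | "k = 14" | "k = 15" | "k = 16" | "k = 17" | "k = 18" | "k = 19" | "k = 20" | "k = 21" | "k = 22" | "k = 23" | "k = 24" by blast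
  then show ?thesis
  proof cases
    case 1
    have "n - 9 < 603"
      by (rule power_prime_count_less[OF le[unfolded 1] prime_count_table(4)]) (simp_all add: fact_numeral)
    then show ?thesis using n 1 by simp
  next
    case 2
    have "n - 10 < 154"
      by (rule power_prime_count_less[OF le[unfolded 2] prime_count_table(5)]) (simp_all add: fact_numeral)
    then show ?thesis using n 2 by simp
  next
    case 3
    have "n - 11 < 342"
      by (rule power_prime_count_less[OF le[unfolded 3] prime_count_table(6)]) (simp_all add: fact_numeral)
    then show ?thesis using n 3 by simp
  next
    case 4
    have "n - 12 < 148"
      by (rule power_prime_count_less[OF le[unfolded 4] prime_count_table(7)]) (simp_all add: fact_numeral)
    then show ?thesis using n 4 by simp
  next
    case 5
    have "n - 13 < 281"
      by (rule power_prime_count_less[OF le[unfolded 5] prime_count_table(8)]) (simp_all add: fact_numeral)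
    then show ?thesis using n 5 by simp
  next
    case 6
    have "n - 14 < 155"
      by (rule power_prime_count_less[OF le[unfolded 6] prime_count_table(9)]) (simp_all add: fact_numeral)
    then show ?thesis using n 6 by simp
  next
    case 7
    have "n - 15 < 105"
      by (rule power_prime_count_less[OF le[unfolded 7] prime_count_table(10)]) (simp_all add: fact_numeral)
    then show ?thesis using n 7 by simp
  next
    case 8
    have "n - 16 < 80"
      by (rule power_prime_count_less[OF le[unfolded 8] prime_count_table(11)]) (simp_all add: fact_numeral)
    then show ?thesis using n 8 by simp
  next
    case 9
    have "n - 17 < 120"
      by (rule power_prime_count_less[OF le[unfolded 9] prime_count_table(12)]) (simp_all add: fact_numeral)
    then show ?thesis using n 9 by simp
  next
    case 10
    have "n - 18 < 95"
      by (rule power_prime_count_less[OF le[unfolded 10] prime_count_table(13)]) (simp_all add: fact_numeral)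
    then show ?thesis using n 10 by simp
  next
    case 11
    have "n - 19 < 137"
      by (rule power_prime_count_less[OF le[unfolded 11] prime_count_table(14)]) (simp_all add: fact_numeral)
    then show ?thesis using n 11 by simp
  next
    case 12
    have "n - 20 < 111"
      by (rule power_prime_count_less[OF le[unfolded 12] prime_count_table(15)]) (simp_all add: fact_numeral)
    then show ?thesis using n 12 by simp
  next
    case 13
    have "n - 21 < 94"
      by (rule power_prime_count_less[OF le[unfolded 13] prime_count_table(16)]) (simp_all add: fact_numeral)
    then show ?thesis using n 13 by simp
  next
    case 14
    have "n - 22 < 82"
      by (rule power_prime_count_less[OF le[unfolded 14] prime_count_table(17)]) (simp_all add: fact_numeral)
    then show ?thesis using n 14 by simp
  next
    case 15
    have "n - 23 < 110"
      by (rule power_prime_count_less[OF le[unfolded 15] prime_count_table(18)]) (simp_all add: fact_numeral)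
    then show ?thesis using n 15 by simp
  next
    case 16
    have "n - 24 < 97"
      by (rule power_prime_count_less[OF le[unfolded 16] prime_count_table(19)]) (simp_all add: fact_numeral)
    then show ?thesis using n 16 by simp
  qed
qed simp

section \<open>Factors of degree k/2\<close>

text \<open>For r = M the listed exceptional indices shrink to M, k and 0, but all even l become
  exceptional through the halving of both edges. The odd l other than M remain.\<close>

lemma half_smooth:
  assumes k: "k = 2 * M" "r = M" and l: "odd l" "l < k" "l \<noteq> M"
  shows "smooth_nat k (n - l)"
  unfolding smooth_nat_def
proof (intro allI impI)
  fix p assume p: "prime p" "p dvd n - l"
  show "p \<le> k"
  proof (rule ccontr)
    assume "\<not> p \<le> k"
    then show False
      using simple_prime[of l p] square_prime[of l p] p l k by (cases "p\<^sup>2 dvd n - l") auto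
  qed
qed

lemma half_indices:
  fixes M :: nat
  shows "card ({..<M} - {i. 2 * i + 1 = M}) = M - M mod 2"
proof (cases "even M")
  case True
  then have "{i. 2 * i + 1 = M} = {}" by auto
  then show ?thesis using True by (auto simp: even_iff_mod_2_eq_zero)
next
  case False
  then obtain j where "M = 2 * j + 1" by (elim oddE)
  then have "{i. 2 * i + 1 = M} = {j}" "j < M" by auto
  then show ?thesis using False by (simp add: odd_iff_mod_2_eq_one)
qed

lemma half_odd_bound:
  assumes k: "k = 2 * M" "r = M" and n: "n = 2 * N + 1"
  shows "(N - M) ^ (M - M mod 2 - prime_count k) \<le> fact (M - 1)"
  unfolding half_indices[symmetric]
proof (rule smooth_odd_run_bound_odd)
  fix i assume "i \<in> {..<M} - {i. 2 * i + 1 = M}"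
  then have "smooth_nat k (n - (2 * i + 1))" using k by (intro half_smooth) auto
  then show "smooth_nat k (2 * N + 1 - (2 * i + 1))" using n by simp
qed (use k4 k nk n in auto)

lemma half_even_bound:
  assumes k: "k = 2 * M" "r = M" and n: "n = 2 * N"
  shows "(n - k) ^ (M - M mod 2 + 1 - prime_count k) \<le> fact (M - 1)"
proof -
  have "(2 * N - k) ^ (card ({..<M} - {i. 2 * i + 1 = M}) - (prime_count k - 1)) \<le> fact (M - 1)"
  proof (rule smooth_odd_run_bound_even)
    fix i assume "i \<in> {..<M} - {i. 2 * i + 1 = M}"
    then have "smooth_nat k (n - (2 * i + 1))" using k by (intro half_smooth) auto
    then show "smooth_nat k (2 * N - (2 * i + 1))" using n by simp
  qed (use k4 k nk n in auto)
  \<comment> \<open>Needed to turn the subtraction of one prime less into an exponent larger by one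
    under truncated subtraction.\<close>
  moreover have "prime_count k > 0"
    unfolding prime_count_def card_gt_0_iff using k4 two_is_prime_nat by (auto intro!: exI[of _ 2])
  then have "M - M mod 2 - (prime_count k - 1) = M - M mod 2 + 1 - prime_count k" by linarith
  ultimately show ?thesis unfolding half_indices n by simp
qed

text \<open>A common weakening of the two parities: n >= (2M+1)^2 gives n - k >= 2M^2 as well as N -
  M >= 2M^2.\<close>

lemma half_bound:
  assumes k: "k = 2 * M" "r = M" and n: "(k + 1)\<^sup>2 \<le> n"
  shows "(2 * M\<^sup>2) ^ (M - M mod 2 - prime_count k) \<le> fact (M - 1)"
proof (cases "even n")
  case True
  then obtain N where N: "n = 2 * N" by (elim evenE)
  have M: "0 < M" "k + 2 * M\<^sup>2 \<le> n" using n k k4 by (auto simp: power2_eq_square)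
  have "(2 * M\<^sup>2) ^ (M - M mod 2 - prime_count k) \<le> (2 * M\<^sup>2) ^ (M - M mod 2 + 1 - prime_count k)"
    using M by (intro power_increasing) auto
  also have "\<dots> \<le> (n - k) ^ (M - M mod 2 + 1 - prime_count k)" using M by (intro power_mono) auto
  also have "\<dots> \<le> fact (M - 1)" by (rule half_even_bound[OF k N])
  finally show ?thesis .
next
  case False
  then obtain N where N: "n = 2 * N + 1" by (elim oddE)
  have "M + 2 * M\<^sup>2 \<le> N" using n k N k4 by (simp add: power2_eq_square)
  then have "(2 * M\<^sup>2) ^ (M - M mod 2 - prime_count k) \<le> (N - M) ^ (M - M mod 2 - prime_count k)"
    by (intro power_mono) auto
  also have "\<dots> \<le> fact (M - 1)" by (rule half_odd_bound[OF k N])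
  finally show ?thesis .
qed

lemma half_less_24:
  assumes k: "k = 2 * M" "r = M" and n: "(k + 1)\<^sup>2 \<le> n"
  shows "M < 24"
proof (rule ccontr)
  assume "\<not> M < 24"
  then have M: "24 \<le> M" by simp
  let ?E = "M - M mod 2 - prime_count k"
  have "real ((2 * M\<^sup>2) ^ ?E) \<le> real (fact (M - 1))"
    using half_bound[OF k n] by (simp only: of_nat_le_iff)
  then have "ln (real ((2 * M\<^sup>2) ^ ?E)) \<le> ln (fact (M - 1))"
    using M by (subst ln_le_cancel_iff) auto
  moreover have "ln (real ((2 * M\<^sup>2) ^ ?E)) = ?E * ln (real (2 * M\<^sup>2))"
    using M by (subst of_nat_power, subst ln_realpow) auto
  moreover have "ln (real (2 * M\<^sup>2)) = ln 2 + 2 * ln M"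
    using M by (simp add: ln_mult ln_realpow)
  moreover have "ln (fact (M - 1) :: real) = ln (fact M) - ln M"
  proof -
    have "(fact M :: real) = M * fact (M - 1)" using M by (subst fact_reduce) auto
    then show ?thesis using M by (simp add: ln_mult)
  qed
  moreover have "ln (fact M :: real) \<le> 1 + ln M + M * ln M - M" using M by (intro ln_fact_le) auto
  ultimately have "?E * (ln 2 + 2 * ln M) \<le> 1 + M * ln M - M" by simp
  \<comment> \<open>The exponent comes from M - 1 - (2M + 13)/4, where 1 bounds
    \<open>M mod 2\<close>.\<close>
  moreover have "(M / 2 - 17 / 4) * (2 / 3 + 2 * ln M) \<le> ?E * (ln 2 + 2 * ln M)"
  proof (intro mult_mono)
    have "M mod 2 \<le> 1" by simp
    then show "M / 2 - 17 / 4 \<le> ?E" using prime_count_le[of k] k by linarith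
    show "2 / 3 + 2 * ln M \<le> ln 2 + 2 * ln M" using ln2_ge_two_thirds by simp
    show "0 \<le> 2 / 3 + 2 * ln (real M)" using M by (intro add_nonneg_nonneg) auto
  qed auto
  \<comment> \<open>The terms M ln M of both sides have cancelled; the contradiction rests on the
    linear terms alone.\<close>
  ultimately have "4 / 3 * M - 23 / 6 \<le> 17 / 2 * ln M" by (simp add: field_simps)
  moreover have "ln M \<le> M / 2 ^ 5 + (5::nat) * (25 / 36) - 1" using M by (intro ln_le_tangent) simp
  ultimately show False using M by simp
qed

lemma half_less_17:
  assumes k: "k = 2 * M" "r = M" and n: "(k + 1)\<^sup>2 \<le> n"
  shows "M < 17"
proof (rule ccontr)
  assume "\<not> M < 17"
  then have "M = 17 \<or> M = 18 \<or> M = 19 \<or> M = 20 \<or> M = 21 \<or> M = 22 \<or> M = 23" using half_less_24[OF k n] by presburger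
  then consider "M = 17" | "M = 18" | "M = 19" | "M = 20" | "M = 21" | "M = 22" | "M = 23" by blast
  then show False
  proof cases
    case 1
    have "(578::nat) ^ (16 - prime_count 34) \<le> fact 16"
      using half_bound[OF k n] k(1) by (simp add: 1)
    from power_prime_count_less[where y = 578, OF this prime_count_table(24)] show False
      by (simp add: fact_numeral)
  next
    case 2
    have "(648::nat) ^ (18 - prime_count 36) \<le> fact 17"
      using half_bound[OF k n] k(1) by (simp add: 2)
    from power_prime_count_less[where y = 648, OF this prime_count_table(25)] show False
      by (simp add: fact_numeral)
  next
    case 3
    have "(722::nat) ^ (18 - prime_count 38) \<le> fact 18"
      using half_bound[OF k n] k(1) by (simp add: 3)
    from power_prime_count_less[where y = 722, OF this prime_count_table(26)] show False
      by (simp add: fact_numeral)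
  next
    case 4
    have "(800::nat) ^ (20 - prime_count 40) \<le> fact 19"
      using half_bound[OF k n] k(1) by (simp add: 4)
    from power_prime_count_less[where y = 800, OF this prime_count_table(27)] show False
      by (simp add: fact_numeral)
  next
    case 5
    have "(882::nat) ^ (20 - prime_count 42) \<le> fact 20"
      using half_bound[OF k n] k(1) by (simp add: 5)
    from power_prime_count_less[where y = 882, OF this prime_count_table(28)] show False
      by (simp add: fact_numeral)
  next
    case 6
    have "(968::nat) ^ (22 - prime_count 44) \<le> fact 21"
      using half_bound[OF k n] k(1) by (simp add: 6)
    from power_prime_count_less[where y = 968, OF this prime_count_table(29)] show False
      by (simp add: fact_numeral)
  next
    case 7
    have "(1058::nat) ^ (22 - prime_count 46) \<le> fact 22"
      using half_bound[OF k n] k(1) by (simp add: 7)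
    from power_prime_count_less[where y = 1058, OF this prime_count_table(30)] show False
      by (simp add: fact_numeral)
  qed
qed

text \<open>For k = 4, 6, 8, 10 and 14 the deletion exponent is 0, so only n < (k+1)^3 is available;
  for k = 18 the exponent is 1 and the cube bound is still the better one. For k = 16, 28 and 32 the
  deletion bound contradicts n >= (k+1)^2.\<close>

lemma half_odd_ranges:
  assumes k: "k = 2 * M" "r = M" and n: "(k + 1)\<^sup>2 \<le> n" and N: "n = 2 * N + 1"
  shows "k = 4 \<and> n \<le> 124 \<or> k = 6 \<and> n \<le> 342 \<or> k = 8 \<and> n \<le> 728 \<or> k = 10 \<and> n \<le> 1330 \<or> k = 12 \<and> n \<le> 253 \<or> k = 14 \<and> n \<le> 3374 \<or> k = 18 \<and> n \<le> 6858 \<or> k = 20 \<and> n \<le> 1225 \<or> k = 22 \<and> n \<le> 3831 \<or> k = 24 \<and> n \<le> 707 \<or> k = 26 \<and> n \<le> 1591 \<or> k = 30 \<and> n \<le> 1117"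
proof -
  have "M = 2 \<or> M = 3 \<or> M = 4 \<or> M = 5 \<or> M = 6 \<or> M = 7 \<or> M = 8 \<or> M = 9 \<or> M = 10 \<or> M = 11 \<or> M = 12 \<or> M = 13 \<or> M = 14 \<or> M = 15 \<or> M = 16"
    using half_less_17[OF k n] k k4 by presburger
  then consider "M = 2" | "M = 3" | "M = 4" | "M = 5" | "M = 6" | "M = 7" | "M = 8" | "M = 9" | "M = 10" | "M = 11" | "M = 12" | "M = 13" | "M = 14" | "M = 15" | "M = 16" by blast
  then show ?thesis
  proof cases
    case 1
    then show ?thesis using n3 k by simp
  next
    case 2
    then show ?thesis using n3 k by simp
  next
    case 3
    then show ?thesis using n3 k by simp
  next
    case 4
    then show ?thesis using n3 k by simp
  next
    case 5
    have "(N - 6) ^ (6 - prime_count 12) \<le> fact 5"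
      using half_odd_bound[OF k N] k(1) by (simp add: 5)
    then have "N - 6 < 121"
      by (rule power_prime_count_less[OF _ prime_count_table(7)]) (simp_all add: fact_numeral)
    then show ?thesis using n n3 k N 5 by simp
  next
    case 6
    then show ?thesis using n3 k by simp
  next
    case 7
    have "(N - 8) ^ (8 - prime_count 16) \<le> fact 7"
      using half_odd_bound[OF k N] k(1) by (simp add: 7)
    then have "N - 8 < 71"
      by (rule power_prime_count_less[OF _ prime_count_table(11)]) (simp_all add: fact_numeral)
    then show ?thesis using n n3 k N 7 by simp
  next
    case 8
    have "(N - 9) ^ (8 - prime_count 18) \<le> fact 8"
      using half_odd_bound[OF k N] k(1) by (simp add: 8)
    then have "N - 9 < 40321"
      by (rule power_prime_count_less[OF _ prime_count_table(13)]) (simp_all add: fact_numeral)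
    then show ?thesis using n n3 k N 8 by simp
  next
    case 9
    have "(N - 10) ^ (10 - prime_count 20) \<le> fact 9"
      using half_odd_bound[OF k N] k(1) by (simp add: 9)
    then have "N - 10 < 603"
      by (rule power_prime_count_less[OF _ prime_count_table(15)]) (simp_all add: fact_numeral)
    then show ?thesis using n n3 k N 9 by simp
  next
    case 10
    have "(N - 11) ^ (10 - prime_count 22) \<le> fact 10"
      using half_odd_bound[OF k N] k(1) by (simp add: 10)
    then have "N - 11 < 1905"
      by (rule power_prime_count_less[OF _ prime_count_table(17)]) (simp_all add: fact_numeral)
    then show ?thesis using n n3 k N 10 by simp
  next
    case 11
    have "(N - 12) ^ (12 - prime_count 24) \<le> fact 11"
      using half_odd_bound[OF k N] k(1) by (simp add: 11)
    then have "N - 12 < 342"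
      by (rule power_prime_count_less[OF _ prime_count_table(19)]) (simp_all add: fact_numeral)
    then show ?thesis using n n3 k N 11 by simp
  next
    case 12
    have "(N - 13) ^ (12 - prime_count 26) \<le> fact 12"
      using half_odd_bound[OF k N] k(1) by (simp add: 12)
    then have "N - 13 < 783"
      by (rule power_prime_count_less[OF _ prime_count_table(20)]) (simp_all add: fact_numeral)
    then show ?thesis using n n3 k N 12 by simp
  next
    case 13
    have "(N - 14) ^ (14 - prime_count 28) \<le> fact 13"
      using half_odd_bound[OF k N] k(1) by (simp add: 13)
    then have "N - 14 < 91"
      by (rule power_prime_count_less[OF _ prime_count_table(21)]) (simp_all add: fact_numeral)
    then show ?thesis using n n3 k N 13 by simp
  next
    case 14
    have "(N - 15) ^ (14 - prime_count 30) \<le> fact 14"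
      using half_odd_bound[OF k N] k(1) by (simp add: 14)
    then have "N - 15 < 544"
      by (rule power_prime_count_less[OF _ prime_count_table(22)]) (simp_all add: fact_numeral)
    then show ?thesis using n n3 k N 14 by simp
  next
    case 15
    have "(N - 16) ^ (16 - prime_count 32) \<le> fact 15"
      using half_odd_bound[OF k N] k(1) by (simp add: 15)
    then have "N - 16 < 266"
      by (rule power_prime_count_less[OF _ prime_count_table(23)]) (simp_all add: fact_numeral)
    then show ?thesis using n n3 k N 15 by simp
  qed
qed

text \<open>The extra unit in the exponent removes every k except 6, where the exponent is still 0
  and the cube bound is used, and 14, where it is 1.\<close>

lemma half_even_ranges:
  assumes k: "k = 2 * M" "r = M" and n: "(k + 1)\<^sup>2 \<le> n" and N: "n = 2 * N"
  shows "k = 6 \<and> n \<le> 342 \<or> k = 14 \<and> n \<le> 734"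
proof -
  have "M = 2 \<or> M = 3 \<or> M = 4 \<or> M = 5 \<or> M = 6 \<or> M = 7 \<or> M = 8 \<or> M = 9 \<or> M = 10 \<or> M = 11 \<or> M = 12 \<or> M = 13 \<or> M = 14 \<or> M = 15 \<or> M = 16"
    using half_less_17[OF k n] k k4 by presburger
  then consider "M = 2" | "M = 3" | "M = 4" | "M = 5" | "M = 6" | "M = 7" | "M = 8" | "M = 9" | "M = 10" | "M = 11" | "M = 12" | "M = 13" | "M = 14" | "M = 15" | "M = 16" by blast
  then show ?thesis
  proof cases
    case 1
    have "(n - 4) ^ (3 - prime_count 4) \<le> fact 1"
      using half_even_bound[OF k N] k(1) by (simp add: 1)
    then have "n - 4 < 2"
      by (rule power_prime_count_less[OF _ prime_count_table(1)]) (simp_all add: fact_numeral)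
    then show ?thesis using n n3 k N 1 by simp
  next
    case 2
    then show ?thesis using n3 k by simp
  next
    case 3
    have "(n - 8) ^ (5 - prime_count 8) \<le> fact 3"
      using half_even_bound[OF k N] k(1) by (simp add: 3)
    then have "n - 8 < 7"
      by (rule power_prime_count_less[OF _ prime_count_table(3)]) (simp_all add: fact_numeral)
    then show ?thesis using n n3 k N 3 by simp
  next
    case 4
    have "(n - 10) ^ (5 - prime_count 10) \<le> fact 4"
      using half_even_bound[OF k N] k(1) by (simp add: 4)
    then have "n - 10 < 25"
      by (rule power_prime_count_less[OF _ prime_count_table(5)]) (simp_all add: fact_numeral)
    then show ?thesis using n n3 k N 4 by simp
  next
    case 5
    have "(n - 12) ^ (7 - prime_count 12) \<le> fact 5"
      using half_even_bound[OF k N] k(1) by (simp add: 5)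
    then have "n - 12 < 11"
      by (rule power_prime_count_less[OF _ prime_count_table(7)]) (simp_all add: fact_numeral)
    then show ?thesis using n n3 k N 5 by simp
  next
    case 6
    have "(n - 14) ^ (7 - prime_count 14) \<le> fact 6"
      using half_even_bound[OF k N] k(1) by (simp add: 6)
    then have "n - 14 < 721"
      by (rule power_prime_count_less[OF _ prime_count_table(9)]) (simp_all add: fact_numeral)
    then show ?thesis using n n3 k N 6 by simp
  next
    case 7
    have "(n - 16) ^ (9 - prime_count 16) \<le> fact 7"
      using half_even_bound[OF k N] k(1) by (simp add: 7)
    then have "n - 16 < 18"
      by (rule power_prime_count_less[OF _ prime_count_table(11)]) (simp_all add: fact_numeral)
    then show ?thesis using n n3 k N 7 by simp
  next
    case 8
    have "(n - 18) ^ (9 - prime_count 18) \<le> fact 8"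
      using half_even_bound[OF k N] k(1) by (simp add: 8)
    then have "n - 18 < 201"
      by (rule power_prime_count_less[OF _ prime_count_table(13)]) (simp_all add: fact_numeral)
    then show ?thesis using n n3 k N 8 by simp
  next
    case 9
    have "(n - 20) ^ (11 - prime_count 20) \<le> fact 9"
      using half_even_bound[OF k N] k(1) by (simp add: 9)
    then have "n - 20 < 72"
      by (rule power_prime_count_less[OF _ prime_count_table(15)]) (simp_all add: fact_numeral)
    then show ?thesis using n n3 k N 9 by simp
  next
    case 10
    have "(n - 22) ^ (11 - prime_count 22) \<le> fact 10"
      using half_even_bound[OF k N] k(1) by (simp add: 10)
    then have "n - 22 < 154"
      by (rule power_prime_count_less[OF _ prime_count_table(17)]) (simp_all add: fact_numeral)
    then show ?thesis using n n3 k N 10 by simp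
  next
    case 11
    have "(n - 24) ^ (13 - prime_count 24) \<le> fact 11"
      using half_even_bound[OF k N] k(1) by (simp add: 11)
    then have "n - 24 < 80"
      by (rule power_prime_count_less[OF _ prime_count_table(19)]) (simp_all add: fact_numeral)
    then show ?thesis using n n3 k N 11 by simp
  next
    case 12
    have "(n - 26) ^ (13 - prime_count 26) \<le> fact 12"
      using half_even_bound[OF k N] k(1) by (simp add: 12)
    then have "n - 26 < 148"
      by (rule power_prime_count_less[OF _ prime_count_table(20)]) (simp_all add: fact_numeral)
    then show ?thesis using n n3 k N 12 by simp
  next
    case 13
    have "(n - 28) ^ (15 - prime_count 28) \<le> fact 13"
      using half_even_bound[OF k N] k(1) by (simp add: 13)
    then have "n - 28 < 43"
      by (rule power_prime_count_less[OF _ prime_count_table(21)]) (simp_all add: fact_numeral)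
    then show ?thesis using n n3 k N 13 by simp
  next
    case 14
    have "(n - 30) ^ (15 - prime_count 30) \<le> fact 14"
      using half_even_bound[OF k N] k(1) by (simp add: 14)
    then have "n - 30 < 155"
      by (rule power_prime_count_less[OF _ prime_count_table(22)]) (simp_all add: fact_numeral)
    then show ?thesis using n n3 k N 14 by simp
  next
    case 15
    have "(n - 32) ^ (17 - prime_count 32) \<le> fact 15"
      using half_even_bound[OF k N] k(1) by (simp add: 15)
    then have "n - 32 < 105"
      by (rule power_prime_count_less[OF _ prime_count_table(23)]) (simp_all add: fact_numeral)
    then show ?thesis using n n3 k N 15 by simp
  qed
qed

end

section \<open>The remaining pairs\<close>

text \<open>\<open>witness n k r q\<close> says that the prime \<open>q\<close>, which divides \<open>n - l\<close> for \<open>l = n mod q\<close>, rules out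
  a factor of degree \<open>r\<close>.\<close>

definition witness :: "int \<Rightarrow> int \<Rightarrow> int \<Rightarrow> int \<Rightarrow> bool" where
  "witness n k r q \<longleftrightarrow> k < q \<and> (let l = n mod q in l \<le> k \<and> l \<noteq> r \<and> l \<noteq> k - r \<and>
     ((n - l) mod (q * q) \<noteq> 0 \<or>
      l \<noteq> 2 * r \<and> l \<noteq> k - 2 * r \<and> (k \<noteq> 2 * r \<or> l mod 2 = 1)))"

definition sweep_primes :: "int list" where
  "sweep_primes = [5, 7, 11, 13, 17, 19, 23, 29, 31, 37, 41, 43, 47, 53, 59, 61, 67, 71, 73, 79, 83, 89, 97, 101, 113, 179, 193]"

definition excluded :: "int \<Rightarrow> int \<Rightarrow> int \<Rightarrow> bool" where
  "excluded n k r \<longleftrightarrow> list_ex (witness n k r) sweep_primes"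

lemma sweep_primes_prime: "list_all prime_test sweep_primes"
  by code_simp

context rigid_degree
begin

text \<open>A witness negates the conclusion of \<open>simple_prime\<close> or of
  \<open>square_prime\<close>, according to whether q^2 divides n - l. Since q > k, the remainder n
  mod q is the only candidate for the index l.\<close>

lemma not_excluded: "\<not> excluded (int n) (int k) (int r)"
proof
  assume "excluded (int n) (int k) (int r)"
  then obtain q' where "q' \<in> set sweep_primes" and w': "witness (int n) (int k) (int r) q'"
    unfolding excluded_def list_ex_iff by blast
  then have t: "prime_test q'" using sweep_primes_prime unfolding list_all_iff by blast
  then have "q' = int (nat q')" by (simp add: prime_test_def)
  then obtain q where q': "q' = int q" by blast
  have q: "prime q" using t unfolding q' by (rule prime_by_test)
  define l where "l = n mod q"
  have il: "int n mod int q = int l" by (simp add: l_def of_nat_mod)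
  have ln: "l \<le> n" "q dvd n - l" by (simp_all add: l_def dvd_minus_mod)
  have w: "k < q" "l \<le> k" "l \<noteq> r" "int l \<noteq> int k - int r"
    "(int n - int l) mod (int q * int q) \<noteq> 0 \<or>
      int l \<noteq> 2 * int r \<and> int l \<noteq> int k - 2 * int r \<and> (int k \<noteq> 2 * int r \<or> int l mod 2 = 1)"
    using w' unfolding witness_def q' il Let_def by auto
  have lkr: "l \<noteq> k - r" using w(4) r2 by auto
  show False
  proof (cases "q\<^sup>2 dvd n - l")
    case True
    then have "int (q\<^sup>2) dvd int (n - l)" by (simp only: int_dvd_int_iff)
    then have "(int n - int l) mod (int q * int q) = 0"
      using ln by (simp add: of_nat_diff power2_eq_square)
    then have *: "l \<noteq> 2 * r" "int l \<noteq> int k - 2 * int r" "k \<noteq> 2 * r \<or> l mod 2 = 1"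
      using w(5) by auto presburger+
    have "l \<noteq> k - 2 * r" using *(2) r2 by auto
    then show False using square_prime[OF w(2) q w(1) True] w(3) lkr * by (auto simp: even_iff_mod_2_eq_zero)
  next
    case False
    then show False using simple_prime[OF w(2) q w(1) ln(2)] w(3) lkr by blast
  qed
qed

lemma sweep_false:
  assumes "list_all (\<lambda>n. list_all (excluded n K) [1..R]) [a..b]"
    and "int k = K" "a \<le> int n" "int n \<le> b" "int r \<le> R"
  shows False
proof -
  have "int n \<in> set [a..b]" "int r \<in> set [1..R]" unfolding set_upto using assms r1 by auto
  then have "excluded (int n) K (int r)" using assms(1) unfolding list_all_iff by blast
  then show False using not_excluded assms(2) by simp
qed

lemma odd_sweep_false:
  assumes "list_all (\<lambda>m. excluded (2 * m + 1) K R) [a..b]"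
    and "int k = K" "int r = R" "n = 2 * m + 1" "a \<le> int m" "int m \<le> b"
  shows False
proof -
  have "int m \<in> set [a..b]" unfolding set_upto using assms by auto
  then have "excluded (2 * int m + 1) K R" using assms(1) unfolding list_all_iff by blast
  then show False using not_excluded assms(2-4) by (simp add: add.commute)
qed

text \<open>Long ranges are evaluated in blocks of fifty values of m, rounded outwards to whole
  blocks.\<close>

lemma block_sweep_false:
  assumes "list_all (\<lambda>j. list_all (\<lambda>m. excluded (2 * m + 1) K R) [50 * j..50 * j + 49]) [a..b]"
    and "int k = K" "int r = R" "n = 2 * m + 1" "a \<le> int m div 50" "int m div 50 \<le> b"
  shows False
proof -
  have "int m div 50 \<in> set [a..b]" unfolding set_upto using assms by auto
  then have *: "list_all (\<lambda>m. excluded (2 * m + 1) K R) [50 * (int m div 50)..50 * (int m div 50) + 49]"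
    using assms(1) unfolding list_all_iff by blast
  show False
    by (rule odd_sweep_false[OF * assms(2-4)]) presburger+
qed

end

text \<open>This check and those for k = 5, ..., 13 treat all r < k/2. They start at n = 2k, or one
  later where n = 2k is exceptional. They end at (k+1)^3 - 1 for k <= 8, at the bound of
  \<open>generic_ranges\<close> for k = 9, 10, 11 and 13, and at (k+1)^2 - 1 for k = 12.\<close>

lemma sweep_4: "list_all (\<lambda>n. list_all (excluded n 4) [1..1]) [9..124]"
  by code_simp

lemma sweep_5: "list_all (\<lambda>n. list_all (excluded n 5) [1..2]) [11..215]"
  by code_simp

lemma sweep_6: "list_all (\<lambda>n. list_all (excluded n 6) [1..2]) [13..342]"
  by code_simp

lemma sweep_7: "list_all (\<lambda>n. list_all (excluded n 7) [1..3]) [14..511]"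
  by code_simp

lemma sweep_8: "list_all (\<lambda>n. list_all (excluded n 8) [1..3]) [17..728]"
  by code_simp

lemma sweep_9: "list_all (\<lambda>n. list_all (excluded n 9) [1..4]) [18..611]"
  by code_simp

lemma sweep_10: "list_all (\<lambda>n. list_all (excluded n 10) [1..4]) [20..163]"
  by code_simp

lemma sweep_11: "list_all (\<lambda>n. list_all (excluded n 11) [1..5]) [22..352]"
  by code_simp

lemma sweep_12: "list_all (\<lambda>n. list_all (excluded n 12) [1..5]) [24..168]"
  by code_simp

lemma sweep_13: "list_all (\<lambda>n. list_all (excluded n 13) [1..6]) [26..293]"
  by code_simp

text \<open>The pairs left by \<open>below_square_small\<close>: 2k <= n <= 58 stops k at 29. Here r
  = k/2 is included.\<close>

lemma sweep_small:
  "list_all (\<lambda>k. list_all (\<lambda>n. list_all (excluded n k) [1..k div 2]) [2 * k..58]) [14..29]"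
  by code_simp

text \<open>With k = 2s the range runs from 2k to (k+1)^2 - 1. It contains (8,4), (12,6) and (16,8):
  the degree that survives there is not k/2.\<close>

lemma half_sweep_small:
  "list_all (\<lambda>s. list_all (\<lambda>n. excluded n (2 * s) s) [4 * s..4 * s * s + 4 * s]) [2..6]"
  by code_simp

lemma half_sweep_6: "list_all (\<lambda>n. excluded n 6 3) [49..342]"
  by code_simp

lemma half_sweep_14: "list_all (\<lambda>n. excluded n 14 7) [225..734]"
  by code_simp

text \<open>The odd n between (k+1)^2 and the bound of \<open>half_odd_ranges\<close>, here and for
  the later k, written as 2m + 1. Even n do not occur because \<open>half_even_ranges\<close> has
  already removed them for these k, except for k = 14, which has its own check.\<close>

lemma odd_sweep_4: "list_all (\<lambda>m. excluded (2 * m + 1) 4 2) [12..61]"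
  by code_simp

lemma odd_sweep_8: "list_all (\<lambda>m. excluded (2 * m + 1) 8 4) [40..363]"
  by code_simp

lemma odd_sweep_10:
  "list_all (\<lambda>j. list_all (\<lambda>m. excluded (2 * m + 1) 10 5) [50 * j..50 * j + 49]) [1..13]"
  by code_simp

lemma odd_sweep_12: "list_all (\<lambda>m. excluded (2 * m + 1) 12 6) [84..126]"
  by code_simp

lemma odd_sweep_14:
  "list_all (\<lambda>j. list_all (\<lambda>m. excluded (2 * m + 1) 14 7) [50 * j..50 * j + 49]) [2..33]"
  by code_simp

lemma odd_sweep_18:
  "list_all (\<lambda>j. list_all (\<lambda>m. excluded (2 * m + 1) 18 9) [50 * j..50 * j + 49]) [3..68]"
  by code_simp

lemma odd_sweep_20: "list_all (\<lambda>m. excluded (2 * m + 1) 20 10) [220..612]"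
  by code_simp

lemma odd_sweep_22:
  "list_all (\<lambda>j. list_all (\<lambda>m. excluded (2 * m + 1) 22 11) [50 * j..50 * j + 49]) [5..38]"
  by code_simp

lemma odd_sweep_24: "list_all (\<lambda>m. excluded (2 * m + 1) 24 12) [312..353]"
  by code_simp

lemma odd_sweep_26: "list_all (\<lambda>m. excluded (2 * m + 1) 26 13) [364..795]"
  by code_simp

lemma odd_sweep_30: "list_all (\<lambda>m. excluded (2 * m + 1) 30 15) [480..558]"
  by code_simp

section \<open>Elimination of all pairs but the exceptional ones\<close>

context rigid_degree
begin

lemma generic_false:
  assumes r: "2 * r \<noteq> k" and ex: "(n, k) \<notin> {(8, 4), (10, 5), (12, 6), (16, 8)}"
    and range: "k \<le> 8 \<or> k \<le> 13 \<and> n < (k + 1)\<^sup>2 \<or> k = 9 \<and> n \<le> 611 \<or> k = 10 \<and> n \<le> 163 \<or>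
      k = 11 \<and> n \<le> 352 \<or> k = 13 \<and> n \<le> 293"
  shows False
proof -
  have "k = 4 \<or> k = 5 \<or> k = 6 \<or> k = 7 \<or> k = 8 \<or> k = 9 \<or> k = 10 \<or> k = 11 \<or> k = 12 \<or> k = 13"
    using range k4 by presburger
  then consider "k = 4" | "k = 5" | "k = 6" | "k = 7" | "k = 8" | "k = 9" | "k = 10" | "k = 11" | "k = 12" | "k = 13" by blast
  then show False
  proof cases
    case 1
    show False
      by (rule sweep_false[OF sweep_4]; use 1 range ex n3 nk r r2 in auto)
  next
    case 2
    show False
      by (rule sweep_false[OF sweep_5]; use 2 range ex n3 nk r r2 in auto)
  next
    case 3
    show False
      by (rule sweep_false[OF sweep_6]; use 3 range ex n3 nk r r2 in auto)
  next
    case 4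
    show False
      by (rule sweep_false[OF sweep_7]; use 4 range ex n3 nk r r2 in auto)
  next
    case 5
    show False
      by (rule sweep_false[OF sweep_8]; use 5 range ex n3 nk r r2 in auto)
  next
    case 6
    show False
      by (rule sweep_false[OF sweep_9]; use 6 range ex n3 nk r r2 in auto)
  next
    case 7
    show False
      by (rule sweep_false[OF sweep_10]; use 7 range ex n3 nk r r2 in auto)
  next
    case 8
    show False
      by (rule sweep_false[OF sweep_11]; use 8 range ex n3 nk r r2 in auto)
  next
    case 9
    show False
      by (rule sweep_false[OF sweep_12]; use 9 range ex n3 nk r r2 in auto)
  next
    case 10
    show False
      by (rule sweep_false[OF sweep_13]; use 10 range ex n3 nk r r2 in auto)
  qed
qed

lemma half_below_square_false:
  assumes r: "2 * r = k" and k: "k < 14" and n: "n < (k + 1)\<^sup>2"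
  shows False
proof -
  have "int r \<in> set [2..6]" unfolding set_upto using r k k4 by auto
  then have "list_all (\<lambda>n. excluded n (2 * int r) (int r)) [4 * int r..4 * int r * int r + 4 * int r]"
    using half_sweep_small unfolding list_all_iff by blast
  moreover have "n \<le> 4 * r * r + 4 * r" using n r by (auto simp: power2_eq_square)
  then have "int n \<le> 4 * int r * int r + 4 * int r" by (metis of_nat_add of_nat_le_iff of_nat_mult of_nat_numeral)
  moreover have "4 * int r \<le> int n" using nk r by simp
  ultimately have "excluded (int n) (2 * int r) (int r)"
    unfolding list_all_iff set_upto by simp
  then show False using not_excluded r by (metis of_nat_mult of_nat_numeral)
qed

lemma small_false:
  assumes "14 \<le> k" "n \<le> 58"
  shows False
proof -
  have "int k \<in> set [14..29]" unfolding set_upto using assms nk by auto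
  then have *: "list_all (\<lambda>n. list_all (excluded n (int k)) [1..int k div 2]) [2 * int k..58]"
    using sweep_small unfolding list_all_iff by blast
  show False by (rule sweep_false[OF *]) (use assms nk r2 in auto)
qed

lemma half_odd_false:
  assumes r: "2 * r = k" and n: "(k + 1)\<^sup>2 \<le> n" and N: "n = 2 * N + 1"
  shows False
proof -
  have "k = 4 \<and> n \<le> 124 \<or> k = 6 \<and> n \<le> 342 \<or> k = 8 \<and> n \<le> 728 \<or> k = 10 \<and> n \<le> 1330 \<or> k = 12 \<and> n \<le> 253 \<or> k = 14 \<and> n \<le> 3374 \<or> k = 18 \<and> n \<le> 6858 \<or> k = 20 \<and> n \<le> 1225 \<or> k = 22 \<and> n \<le> 3831 \<or> k = 24 \<and> n \<le> 707 \<or> k = 26 \<and> n \<le> 1591 \<or> k = 30 \<and> n \<le> 1117"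
    using half_odd_ranges[of r, OF r[symmetric] refl n N] .
  then show False
  proof (elim disjE conjE)
    assume b: "k = 4" "n \<le> 124"
    show False
      by (rule odd_sweep_false[OF odd_sweep_4 _ _ N]; use b n N r in simp)
  next
    assume b: "k = 6" "n \<le> 342"
    have "excluded (int n) 6 3"
      using half_sweep_6 b n unfolding list_all_iff set_upto by simp
    then show False using not_excluded b r by simp
  next
    assume b: "k = 8" "n \<le> 728"
    show False
      by (rule odd_sweep_false[OF odd_sweep_8 _ _ N]; use b n N r in simp)
  next
    assume b: "k = 10" "n \<le> 1330"
    show False
      by (rule block_sweep_false[OF odd_sweep_10 _ _ N]; use b n N r in simp)
  next
    assume b: "k = 12" "n \<le> 253"
    show False
      by (rule odd_sweep_false[OF odd_sweep_12 _ _ N]; use b n N r in simp)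
  next
    assume b: "k = 14" "n \<le> 3374"
    show False
      by (rule block_sweep_false[OF odd_sweep_14 _ _ N]; use b n N r in simp)
  next
    assume b: "k = 18" "n \<le> 6858"
    show False
      by (rule block_sweep_false[OF odd_sweep_18 _ _ N]; use b n N r in simp)
  next
    assume b: "k = 20" "n \<le> 1225"
    show False
      by (rule odd_sweep_false[OF odd_sweep_20 _ _ N]; use b n N r in simp)
  next
    assume b: "k = 22" "n \<le> 3831"
    show False
      by (rule block_sweep_false[OF odd_sweep_22 _ _ N]; use b n N r in simp)
  next
    assume b: "k = 24" "n \<le> 707"
    show False
      by (rule odd_sweep_false[OF odd_sweep_24 _ _ N]; use b n N r in simp)
  next
    assume b: "k = 26" "n \<le> 1591"
    show False
      by (rule odd_sweep_false[OF odd_sweep_26 _ _ N]; use b n N r in simp)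
  next
    assume b: "k = 30" "n \<le> 1117"
    show False
      by (rule odd_sweep_false[OF odd_sweep_30 _ _ N]; use b n N r in simp)
  qed
qed

lemma half_even_false:
  assumes r: "2 * r = k" and n: "(k + 1)\<^sup>2 \<le> n" and N: "n = 2 * N"
  shows False
proof -
  have "k = 6 \<and> n \<le> 342 \<or> k = 14 \<and> n \<le> 734"
    using half_even_ranges[of r, OF r[symmetric] refl n N] .
  then consider "k = 6" "n \<le> 342" | "k = 14" "n \<le> 734" by blast
  then show False
  proof cases
    case 1
    have "excluded (int n) 6 3" using half_sweep_6 1 n unfolding list_all_iff set_upto by simp
    then show False using not_excluded 1 r by simp
  next
    case 2
    have "excluded (int n) 14 7" using half_sweep_14 2 n unfolding list_all_iff set_upto by simp
    then show False using not_excluded 2 r by simp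
  qed
qed

lemma exceptional: "(n, k) \<in> {(8, 4), (10, 5), (12, 6), (16, 8)}"
proof (rule ccontr)
  assume ex: "\<not> ?thesis"
  show False
  proof (cases "n < (k + 1)\<^sup>2")
    case True
    show False
    proof (cases "k < 14")
      case k: True
      show False
      proof (cases "2 * r = k")
        case r: True
        show False by (rule half_below_square_false[OF r k True])
      next
        case r: False
        show False by (rule generic_false[OF r ex]) (use k True in simp)
      qed
    next
      case False
      then show False using below_square_small[OF True] small_false by simp
    qed
  next
    case False
    then have n: "(k + 1)\<^sup>2 \<le> n" by simp
    show False
    proof (cases "2 * r = k")
      case r: True
      show False using half_even_false[OF r n] half_odd_false[OF r n] by (cases "even n") (auto elim: evenE oddE)
    next
      case r: False
      show False by (rule generic_false[OF r ex]) (use generic_ranges[OF n r] in blast)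
    qed
  qed
qed

end

theorem theorem1p2:
  fixes n k :: nat and a :: "nat \<Rightarrow> int"
  assumes "k > 0" and "n > 0"
    and "8 \<le> 2 * k" and "2 * k \<le> n" and "n < (k + 1) ^ 3"
    and "\<And>j. j \<le> k \<Longrightarrow> a j \<noteq> 0"
    and "\<And>j p. j \<le> k \<Longrightarrow> prime p \<Longrightarrow> p dvd a j \<Longrightarrow> p \<le> int k"
    and "(n, k) \<notin> {(8, 4), (10, 5), (12, 6), (16, 8)}"
  shows "irreducible (F_poly n k a)"
proof (rule ccontr)
  assume red: "\<not> irreducible (F_poly n k a)"
  have kn: "k < n" using assms by linarith
  have "\<exists>r\<ge>1. 2 * r \<le> k \<and> newton_compatible n k r"
    using assms(1) kn assms(6,7) red by (rule reducible_newton_compatible)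
  then obtain r where r: "1 \<le> r" "2 * r \<le> k" "newton_compatible n k r" by blast
  have "rigid_degree n k r"
  proof
    fix l p :: nat
    assume l: "l \<le> k" and p: "prime p" "k < p"
    show "l = r \<or> l = k - r" if "p dvd n - l" "\<not> p\<^sup>2 dvd n - l"
      by (rule newton_compatible_simple[OF r(3,1,2) l p that kn])
    show "l \<in> {r, k - r, 2 * r, k - 2 * r} \<or> 2 * r = k \<and> even l" if "p\<^sup>2 dvd n - l"
      by (rule newton_compatible_square[OF r(3,1,2) l p that assms(5) kn])
  qed (use assms r in auto)
  then show False using rigid_degree.exceptional assms(8) by blast
qed

end
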